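(* Let $g$ be a positive integer and $p$ a prime with $p\geq 2g+1$. With $M$, $J_{\vec m}(z)$, $I^m(z)$ and the KZ equations as defined in the context, the following statements hold. (i) For any $\vec m\in M$, we have $J_{\vec m}(z)\in\mathbb F_p[z]^{2g+1}$. (ii) For any $\vec m\in M$, the polynomial vector $J_{\vec m}(z)$ is a solution of the KZ equations. (iii) The $\mathbb F_p[z^p]$-module spanned by $J_{\vec m}(z)$, $\vec m\in M$, coincides with the $\mathbb F_p[z^p]$-module $\mathcal M_{g,p}$ spanned by $I^m(z)$, $m=0,\dots,g-1$.
   Context: Notation: $z=(z_1,\dots,z_{2g+1})$, $\mathbb F_p[z]=\mathbb F_p[z_1,\dots,z_{2g+1}]$, $\mathbb F_p[z^p]=\mathbb F_p[z_1^p,\dots,z_{2g+1}^p]$. KZ equations (over $\mathbb F_p$), for a column vector $I=(I_1,\dots,I_{2g+1})$ of polynomials in $z$: $$\frac{\partial I}{\partial z_i}=\frac12\sum_{j\ne i}\frac{\Omega^{(i,j)}}{z_i-z_j}I,\quad i=1,\dots,2g+1,\qquad I_1+\dots+I_{2g+1}=0,$$ where $\Omega^{(i,j)}$ is the $(2g+1)\times(2g+1)$ matrix with entries $-1$ at positions $(i,i)$ and $(j,j)$, $1$ at positions $(i,j)$ and $(j,i)$, and $0$ elsewhere. Solutions $I^m$. Let $\Phi_p(t,z)=\prod_{a=1}^{2g+1}(t-z_a)^{(p-1)/2}\in\mathbb F_p[t,z]$, $P(t,z)=(P_1,\dots,P_{2g+1})$ with $P_j(t,z)=\frac1{t-z_j}\Phi_p(t,z)$,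 and write $P(t,z)=\sum_iP^i(z)t^i$. Set $I^m(z):=P^{(g-m)p-1}(z)$ for $m=0,\dots,g-1$, and $\mathcal M_{g,p}=\{\sum_{m=0}^{g-1}c_m(z)I^m(z)\mid c_m(z)\in\mathbb F_p[z^p]\}$. (It is known that each $I^m(z)$ is a solution of the KZ equations over $\mathbb F_p$.) The sets $\Delta^r_s$. For $r=0,\dots,g-1$, $s=0,\dots,g$, $$\Delta^r_s=\Big\{(\ell_3,\dots,\ell_{2g+1})\in\mathbb Z_{\ge0}^{2g-1}\ \Big|\ 0\le\sum_{i=3}^{2g+1}\ell_i+s-rp\le\tfrac{p-1}2,\ \ \ell_i\le\tfrac{p-1}2\text{ for all } i\Big\}.$$ Cartier–Manin matrix. For $r,s\in\{0,\dots,g-1\}$, $C^r_s(\lambda)\in\mathbb F_p[\lambda_3,\dots,\lambda_{2g+1}]$ is the coefficient of $x^{(g-r)p-1}$ in $x^{g-s-1}\big(x(x-1)(x-\lambda_3)\cdots(x-\lambda_{2g+1})\big)^{(p-1)/2}$. The vectors $K^m$. For $m\in\{0,\dots,g-1\}$, $K^m(\lambda)=\sum_{\ell\in\Delta^m_g}K^m_\ell(\lambda)\in\mathbb F_p[\lambda_3,\dots,\lambda_{2g+1}]^{2g+1}$, where $$K^m_\ell(\lambda)=(-1)^{(p-1)/2+mp-g}\binom{(p-1)/2}{\sum_{i=3}^{2g+1}\ell_i+g-mp}\prod_{i=3}^{2g+1}\binom{(p-1)/2}{\ell_i}\lambda_3^{\ell_3}\cdots\lambda_{2g+1}^{\ell_{2g+1}}\Big(1,\,-2\sum_{i=3}^{2g+1}\ell_i-2g,\,2\ell_3+1,\dots,2\ell_{2g+1}+1\Big).$$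 The set $M$: all finite sequences $\vec m=(m_0,\dots,m_{a+1})$ with $a\in\mathbb Z_{\ge0}$, $m_0=g$, $m_j\in\mathbb Z_{\ge0}$ and $m_j<g$ for $j=1,\dots,a+1$. For $\vec m\in M$ define $$K_{\vec m}(\lambda)=(-1)^{a(p-1)/2}\binom{2m_{a+1}}{m_{a+1}}\Big(\prod_{j=1}^aC^{m_{j+1}}_{m_j}(\lambda_3^{p^j},\dots,\lambda_{2g+1}^{p^j})\Big)K^{m_1}(\lambda_3,\dots,\lambda_{2g+1}),$$ $$J_{\vec m}(z)=(z_2-z_1)^{(p-1)/2-g+m_{a+1}p^{a+1}+(p+\dots+p^a)(p-1)/2}\,K_{\vec m}\Big(\frac{z_3-z_1}{z_2-z_1},\dots,\frac{z_{2g+1}-z_1}{z_2-z_1}\Big),$$ where $p+\dots+p^a$ is $0$ for $a=0$; a priori $J_{\vec m}(z)$ is a vector of rational functions in $z$. *)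

theory Defs
  imports
    "HOL-Library.Poly_Mapping"
    "HOL-Computational_Algebra.Polynomial_Factorial"
    "Berlekamp_Zassenhaus.Finite_Field"
begin

text \<open>
  The field with \<open>p\<close> elements is \<open>'p mod_ring\<close> for a type \<open>'p\<close> of class \<open>prime_card\<close>,
  i.e. \<open>p = CARD('p)\<close> is prime.  Multivariate polynomials have variables indexed by all of
  \<open>nat\<close>; membership in a polynomial ring with variables \<open>i \<in> V\<close> is expressed by \<open>polys_in V\<close>.
  The index \<open>i\<close> stands for \<open>z\<^sub>i\<close> or for \<open>\<lambda>\<^sub>i\<close>, according to context.
\<close>

type_synonym 'k mpoly = "(nat \<Rightarrow>\<^sub>0 nat) \<Rightarrow>\<^sub>0 'k"

definition Const :: "'k::zero \<Rightarrow> 'k mpoly" where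
  "Const c = Poly_Mapping.single 0 c"

definition Var :: "nat \<Rightarrow> 'k::zero_neq_one mpoly" where
  "Var i = Poly_Mapping.single (Poly_Mapping.single i 1) 1"

definition polys_in :: "nat set \<Rightarrow> 'k::zero mpoly set" where
  "polys_in V = {f. \<forall>m\<in>Poly_Mapping.keys f. Poly_Mapping.keys m \<subseteq> V}"

text \<open>Substitution of \<open>x i\<close> for the \<open>i\<close>-th variable, coefficients being mapped by \<open>h\<close>.\<close>

definition msubst ::
  "('k::zero \<Rightarrow> 'b::comm_semiring_1) \<Rightarrow> (nat \<Rightarrow> 'b) \<Rightarrow> 'k mpoly \<Rightarrow> 'b" where
  "msubst h x f = (\<Sum>m\<in>Poly_Mapping.keys f.
     h (Poly_Mapping.lookup f m) *
     (\<Prod>i\<in>Poly_Mapping.keys m. x i ^ Poly_Mapping.lookup m i))"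

text \<open>The subtraction \<open>m - single i 1\<close> truncates only when \<open>z\<^sub>i\<close> does not occur in
  the monomial \<open>m\<close>, and then the coefficient is zero.\<close>

definition pderiv_var :: "nat \<Rightarrow> 'k::comm_semiring_1 mpoly \<Rightarrow> 'k mpoly" where
  "pderiv_var i f = (\<Sum>m\<in>Poly_Mapping.keys f.
     Poly_Mapping.single (m - Poly_Mapping.single i 1)
       (of_nat (Poly_Mapping.lookup m i) * Poly_Mapping.lookup f m))"

text \<open>
  Column vectors of length \<open>2g + 1\<close> are functions on \<open>nat\<close> that vanish outside
  \<open>{1..2g+1}\<close>.  The rational functions are the elements of \<open>'k mpoly fract\<close>, and
  \<open>vec_to_fract\<close> is the inclusion of polynomial vectors into vectors of rational functions.
\<close>

definition poly_vecs :: "nat \<Rightarrow> (nat \<Rightarrow> 'k::zero mpoly) set" where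
  "poly_vecs g = {F. (\<forall>i\<in>{1..2*g+1}. F i \<in> polys_in {1..2*g+1}) \<and>
                     (\<forall>i. i \<notin> {1..2*g+1} \<longrightarrow> F i = 0)}"

definition vec_to_fract :: "(nat \<Rightarrow> 'k::field mpoly) \<Rightarrow> nat \<Rightarrow> 'k mpoly fract" where
  "vec_to_fract F = (\<lambda>i. to_fract (F i))"

definition Omega :: "nat \<Rightarrow> nat \<Rightarrow> nat \<Rightarrow> nat \<Rightarrow> 'b::ring_1" where
  "Omega i j k l =
     (if (k, l) = (i, i) \<or> (k, l) = (j, j) then - 1
      else if (k, l) = (i, j) \<or> (k, l) = (j, i) then 1
      else 0)"

text \<open>The KZ equations, an identity of vectors of rational functions.\<close>

definition KZ_solution :: "nat \<Rightarrow> (nat \<Rightarrow> 'k::field mpoly) \<Rightarrow> bool" where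
  "KZ_solution g F \<longleftrightarrow>
     (\<forall>i\<in>{1..2*g+1}. \<forall>k\<in>{1..2*g+1}.
        to_fract (pderiv_var i (F k)) =
          1 / 2 * (\<Sum>j\<in>{1..2*g+1} - {i}.
            (\<Sum>l\<in>{1..2*g+1}. Omega i j k l * to_fract (F l)) / to_fract (Var i - Var j))) \<and>
     (\<Sum>k\<in>{1..2*g+1}. F k) = 0"

text \<open>Polynomials in \<open>t\<close> (or in \<open>x\<close>) with coefficients in \<open>\<F>\<^sub>p[z]\<close> are elements of
  \<open>'p mod_ring mpoly poly\<close>, and \<open>[:- Var a, 1:]\<close> is \<open>t - z\<^sub>a\<close>.\<close>

definition Phi :: "nat \<Rightarrow> 'p::prime_card mod_ring mpoly poly" where
  "Phi g = (\<Prod>a\<in>{1..2*g+1}. [:- Var a, 1:] ^ ((CARD('p) - 1) div 2))"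

text \<open>\<open>synthetic_div f c\<close> is the quotient of \<open>f\<close> by \<open>t - c\<close>; the division is exact here,
  as shown below.\<close>

definition P_vec :: "nat \<Rightarrow> nat \<Rightarrow> 'p::prime_card mod_ring mpoly poly" where
  "P_vec g j = synthetic_div (Phi g) (Var j)"

lemma P_vec_exact:
  assumes "j \<in> {1..2*g+1}" and "CARD('p::prime_card) \<ge> 3"
  shows "[:- Var j, 1:] * P_vec g j = (Phi g :: 'p mod_ring mpoly poly)"
proof -
  have "(CARD('p) - 1) div 2 > 0"
    using assms(2) by simp
  then have "poly (Phi g :: 'p mod_ring mpoly poly) (Var j) = 0"
    unfolding Phi_def poly_prod
    by (intro prod_zero) (use assms(1) in auto)
  then show ?thesis
    using synthetic_div_correct'[of "Var j" "Phi g :: 'p mod_ring mpoly poly"]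
    by (simp add: P_vec_def)
qed

definition I_vec :: "nat \<Rightarrow> nat \<Rightarrow> nat \<Rightarrow> 'p::prime_card mod_ring mpoly" where
  "I_vec g m = (\<lambda>j. if j \<in> {1..2*g+1} then coeff (P_vec g j) ((g - m) * CARD('p) - 1) else 0)"

text \<open>The ring \<open>\<F>\<^sub>p[z\<^sub>1\<^sup>p, \<dots>, z\<^sub>2\<^sub>g\<^sub>+\<^sub>1\<^sup>p]\<close>.\<close>

definition Fp_zp :: "nat \<Rightarrow> 'p::prime_card mod_ring mpoly set" where
  "Fp_zp g = msubst Const (\<lambda>i. Var i ^ CARD('p)) ` polys_in {1..2*g+1}"

definition M_module :: "nat \<Rightarrow> (nat \<Rightarrow> 'p::prime_card mod_ring mpoly) set" where
  "M_module g = {(\<lambda>i. \<Sum>m<g. c m * I_vec g m i) | c. \<forall>m<g. c m \<in> Fp_zp g}"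

text \<open>A tuple \<open>(\<ell>\<^sub>3, \<dots>, \<ell>\<^sub>2\<^sub>g\<^sub>+\<^sub>1)\<close> is also the exponent of the monomial
  \<open>\<lambda>\<^sub>3^\<ell>\<^sub>3 \<dots> \<lambda>\<^sub>2\<^sub>g\<^sub>+\<^sub>1^\<ell>\<^sub>2\<^sub>g\<^sub>+\<^sub>1\<close>.\<close>

definition sum_l :: "nat \<Rightarrow> (nat \<Rightarrow>\<^sub>0 nat) \<Rightarrow> nat" where
  "sum_l g l = (\<Sum>i\<in>{3..2*g+1}. Poly_Mapping.lookup l i)"

definition Delta :: "nat \<Rightarrow> nat \<Rightarrow> nat \<Rightarrow> nat \<Rightarrow> (nat \<Rightarrow>\<^sub>0 nat) set" where
  "Delta p g r s =
     {l. Poly_Mapping.keys l \<subseteq> {3..2*g+1} \<and>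
         0 \<le> int (sum_l g l) + int s - int r * int p \<and>
         int (sum_l g l) + int s - int r * int p \<le> (int p - 1) div 2 \<and>
         (\<forall>i\<in>{3..2*g+1}. Poly_Mapping.lookup l i \<le> (p - 1) div 2)}"

definition Cartier_Manin :: "nat \<Rightarrow> nat \<Rightarrow> nat \<Rightarrow> 'p::prime_card mod_ring mpoly" where
  "Cartier_Manin g r s =
     coeff (monom 1 (g - s - 1) *
            ([:0, 1:] * [:- 1, 1:] * (\<Prod>i\<in>{3..2*g+1}. [:- Var i, 1:])) ^ ((CARD('p) - 1) div 2))
       ((g - r) * CARD('p) - 1)"

text \<open>All subtractions of natural numbers here and below are exact for \<open>2g + 1 \<le> p\<close> and
  \<open>l \<in> Delta p g m g\<close>.\<close>

definition K_coeff :: "nat \<Rightarrow> nat \<Rightarrow> (nat \<Rightarrow>\<^sub>0 nat) \<Rightarrow> 'p::prime_card mod_ring" where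
  "K_coeff g m l =
     (- 1) ^ ((CARD('p) - 1) div 2 + m * CARD('p) - g) *
     of_nat (((CARD('p) - 1) div 2) choose (sum_l g l + g - m * CARD('p))) *
     (\<Prod>i\<in>{3..2*g+1}. of_nat (((CARD('p) - 1) div 2) choose Poly_Mapping.lookup l i))"

definition K_dir :: "nat \<Rightarrow> (nat \<Rightarrow>\<^sub>0 nat) \<Rightarrow> nat \<Rightarrow> 'p::prime_card mod_ring" where
  "K_dir g l i =
     (if i = 1 then 1
      else if i = 2 then - 2 * of_nat (sum_l g l) - 2 * of_nat g
      else if i \<in> {3..2*g+1} then 2 * of_nat (Poly_Mapping.lookup l i) + 1
      else 0)"

definition K_vec :: "nat \<Rightarrow> nat \<Rightarrow> nat \<Rightarrow> 'p::prime_card mod_ring mpoly" where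
  "K_vec g m i =
     (\<Sum>l\<in>Delta CARD('p) g m g. Poly_Mapping.single l (K_coeff g m l * K_dir g l i))"

text \<open>A sequence \<open>(m\<^sub>0, \<dots>, m\<^sub>a\<^sub>+\<^sub>1)\<close> is a list \<open>ms\<close> of length \<open>a + 2\<close>.\<close>

definition M_seqs :: "nat \<Rightarrow> nat list set" where
  "M_seqs g = {ms. \<exists>a. length ms = a + 2 \<and> ms ! 0 = g \<and> (\<forall>j\<in>{1..a+1}. ms ! j < g)}"

definition K_seq :: "nat \<Rightarrow> nat list \<Rightarrow> nat \<Rightarrow> 'p::prime_card mod_ring mpoly" where
  "K_seq g ms i =
     (let a = length ms - 2 in
       (- 1) ^ (a * ((CARD('p) - 1) div 2)) *
       of_nat ((2 * ms ! (a + 1)) choose (ms ! (a + 1))) *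
       (\<Prod>j\<in>{1..a}. msubst Const (\<lambda>k. Var k ^ (CARD('p) ^ j))
                       (Cartier_Manin g (ms ! (j + 1)) (ms ! j))) *
       K_vec g (ms ! 1) i)"

definition J_seq :: "nat \<Rightarrow> nat list \<Rightarrow> nat \<Rightarrow> 'p::prime_card mod_ring mpoly fract" where
  "J_seq g ms i =
     (let a = length ms - 2; p = CARD('p) in
       to_fract (Var 2 - Var 1) ^
         ((p - 1) div 2 - g + ms ! (a + 1) * p ^ (a + 1) + (\<Sum>j\<in>{1..a}. p ^ j) * ((p - 1) div 2)) *
       msubst (\<lambda>c. to_fract (Const c))
         (\<lambda>j. to_fract (Var j - Var 1) / to_fract (Var 2 - Var 1)) (K_seq g ms i))"

text \<open>The \<open>\<F>\<^sub>p[z\<^sup>p]\<close>-submodule of \<open>\<F>\<^sub>p(z)\<^sup>2\<^sup>g\<^sup>+\<^sup>1\<close> spanned by all \<open>J_seq g ms\<close>.\<close>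

definition J_module :: "nat \<Rightarrow> (nat \<Rightarrow> 'p::prime_card mod_ring mpoly fract) set" where
  "J_module g =
     {(\<lambda>i. \<Sum>ms\<in>S. to_fract (c ms) * J_seq g ms i) | S c.
        finite S \<and> S \<subseteq> M_seqs g \<and> (\<forall>ms\<in>S. c ms \<in> Fp_zp g)}"

end

(*
  Put q = (p-1)/2 and Q_j(x, z) = P_j(x + z_1, z).  The polynomials P_j satisfy
  2 (z_i - z_k) dP_k/dz_i = P_i - P_k for i <> k, and sum_j P_j = -2 dPhi_p/dt, whose
  coefficients of t^(np-1) vanish; so every I^m solves the KZ equations.  As (i choose np-1) is
  divisible by p unless p divides i + 1, the coefficients of x^(kp-1) in Q are combinations of
  those of t^(kp-1) in P with coefficients in F_p[z_1^p], and vice versa: the coefficients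
  Q^((g-m)p-1) also span M_{g,p}.  By homogeneity, Q^((g-m)p-1) is (z_2-z_1)^(q-g+mp) times K^m
  at the normalized points, and (z_2-z_1)^(q-s+rp) C^r_s is a polynomial, a coefficient of
  Phi_p(x + z_1, z).  Over F_p, substituting p^j-th powers for the variables is raising to the
  power p^j.  Hence J for (m_0,...,m_(a+1)) is an element of F_p[z^p] times Q^((g-m_1)p-1), and
  for a = 0 this element is the nonzero constant (2m_1 choose m_1).
*)

theory Submission
  imports Defs
begin

text \<open>Sending the points to 0, 1, lambda is a translation by z_1 followed by a scaling. The
  scaling costs only a power of z_2 - z_1, but the translation mixes coefficients of P, so that J is
  not directly a scalar times one I^m; this is why Q is interposed. The mixing is harmless because
  the exponents kp-1 with 1 <= k <= g form a closed system: the degree of P_j is too small for k =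
  g+1. The change of generators is then a g x g matrix over F_p[z^p], and translating back by -z_1
  provides its inverse. The direction vector in K^m measures the effect of lowering one exponent
  from q to q-1: as 2q = -1 in F_p, (q-1 choose k) is (2k+1) (q choose k), and (q-1 choose k-1) is
  -2k (q choose k). The bound p >= 2g+1 enters through q >= g, which makes the exponents q-g+mp and
  q-s+rp genuine differences, and through 2m < p, which makes (2m choose m) invertible.\<close>

section \<open>Expansion of polynomials into monomials\<close>

lemma poly_mapping_eq_sum_single:
  fixes f :: "'a \<Rightarrow>\<^sub>0 'b::comm_monoid_add"
  assumes "finite A" "Poly_Mapping.keys f \<subseteq> A"
  shows "f = (\<Sum>m\<in>A. Poly_Mapping.single m (Poly_Mapping.lookup f m))"
proof (rule poly_mapping_eqI)
  fix k
  have "Poly_Mapping.lookup (\<Sum>m\<in>A. Poly_Mapping.single m (Poly_Mapping.lookup f m)) k =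
      (\<Sum>m\<in>A. if m = k then Poly_Mapping.lookup f k else 0)"
    by (auto simp: lookup_sum lookup_single when_def intro!: sum.cong)
  also have "\<dots> = Poly_Mapping.lookup f k"
    using assms by (auto simp: in_keys_iff)
  finally show "Poly_Mapping.lookup f k =
      Poly_Mapping.lookup (\<Sum>m\<in>A. Poly_Mapping.single m (Poly_Mapping.lookup f m)) k" by simp
qed

lemma additive_sum:
  fixes F :: "'a::comm_monoid_add \<Rightarrow> 'b::comm_monoid_add"
  assumes "F 0 = 0" "\<And>x y. F (x + y) = F x + F y"
  shows "F (sum f A) = (\<Sum>a\<in>A. F (f a))"
  by (induction A rule: infinite_finite_induct) (auto simp: assms)

text \<open>Reduces multiplicativity of a substitution and the Leibniz rule of a partial derivative
  to pairs of monomials.\<close>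

lemma additive_expand:
  fixes F :: "('a \<Rightarrow>\<^sub>0 'b::comm_monoid_add) \<Rightarrow> 'c::comm_monoid_add"
  assumes "F 0 = 0" "\<And>x y. F (x + y) = F x + F y"
  shows "F f = (\<Sum>m\<in>Poly_Mapping.keys f. F (Poly_Mapping.single m (Poly_Mapping.lookup f m)))"
  by (subst poly_mapping_eq_sum_single[of "Poly_Mapping.keys f" f])
     (auto simp: additive_sum[of F] assms)

lemma mpoly_mult_expand:
  fixes f g :: "'k::comm_semiring_1 mpoly"
  shows "f * g = (\<Sum>a\<in>Poly_Mapping.keys f. \<Sum>b\<in>Poly_Mapping.keys g.
    Poly_Mapping.single a (Poly_Mapping.lookup f a) * Poly_Mapping.single b (Poly_Mapping.lookup g b))"
  by (subst poly_mapping_eq_sum_single[of "Poly_Mapping.keys f" f],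
      simp, simp, subst poly_mapping_eq_sum_single[of "Poly_Mapping.keys g" g])
     (auto simp: sum_product)

section \<open>Substitution\<close>

definition monom_val :: "(nat \<Rightarrow> 'b::comm_semiring_1) \<Rightarrow> (nat \<Rightarrow>\<^sub>0 nat) \<Rightarrow> 'b" where
  "monom_val x m = (\<Prod>i\<in>Poly_Mapping.keys m. x i ^ Poly_Mapping.lookup m i)"

lemma monom_val_superset:
  assumes "finite A" "Poly_Mapping.keys m \<subseteq> A"
  shows "monom_val x m = (\<Prod>i\<in>A. x i ^ Poly_Mapping.lookup m i)"
  unfolding monom_val_def
  by (rule prod.mono_neutral_left) (use assms in \<open>auto simp: in_keys_iff\<close>)

lemma monom_val_add: "monom_val x (m + n) = monom_val x m * monom_val x n"
proof -
  let ?A = "Poly_Mapping.keys m \<union> Poly_Mapping.keys n"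
  have "Poly_Mapping.keys (m + n) \<subseteq> ?A" by (rule keys_add)
  then show ?thesis
    by (simp add: monom_val_superset[of ?A] lookup_add power_add prod.distrib)
qed

lemma monom_val_0 [simp]: "monom_val x 0 = 1"
  by (simp add: monom_val_def)

lemma monom_val_single [simp]: "monom_val x (Poly_Mapping.single i n) = x i ^ n"
  by (auto simp: monom_val_superset[of "{i}"])

lemma comm_ring_hom_msubst:
  fixes h :: "'k::comm_ring_1 \<Rightarrow> 'b::comm_ring_1"
  assumes "comm_ring_hom h"
  shows "comm_ring_hom (msubst h x)"
proof -
  interpret h: comm_ring_hom h by fact
  \<comment> \<open>Cancellation can shrink the keys of a sum. Summing over an arbitrary finite
    superset lets both sides of additivity share one index set.\<close>
  have superset: "msubst h x f = (\<Sum>m\<in>A. h (Poly_Mapping.lookup f m) * monom_val x m)"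
    if "finite A" "Poly_Mapping.keys f \<subseteq> A" for f A
    unfolding msubst_def monom_val_def
    by (rule sum.mono_neutral_left) (use that in \<open>auto simp: in_keys_iff\<close>)
  have single: "msubst h x (Poly_Mapping.single m c) = h c * monom_val x m" for m c
    by (subst superset[of "{m}"]) auto
  have add: "msubst h x (f + g) = msubst h x f + msubst h x g" for f g
    using keys_add[of f g]
    by (subst (1 2 3) superset[of "Poly_Mapping.keys f \<union> Poly_Mapping.keys g"])
       (auto simp: lookup_add h.hom_add ring_distribs sum.distrib)
  have zero: "msubst h x 0 = 0"
    by (simp add: msubst_def)
  note sum = additive_sum[of "msubst h x", OF zero add]
  note expand = additive_expand[of "msubst h x", OF zero add]
  have mult: "msubst h x (f * g) = msubst h x f * msubst h x g" for f g
    by (subst mpoly_mult_expand, subst (2 3) expand)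
       (simp add: sum sum_product mult_single single monom_val_add h.hom_mult mult_ac)
  show ?thesis
    by unfold_locales
       (auto simp: zero add mult single simp flip: single_one)
qed

lemma msubst_single:
  assumes "h 0 = 0"
  shows "msubst h x (Poly_Mapping.single m c) = h c * monom_val x m"
  using assms by (auto simp: msubst_def monom_val_def)

lemma msubst_Const: "h 0 = 0 \<Longrightarrow> msubst h x (Const c) = h c"
  by (simp add: Const_def msubst_single)

lemma msubst_Var: "h 0 = 0 \<Longrightarrow> h 1 = 1 \<Longrightarrow> msubst h x (Var i) = x i"
  by (simp add: Var_def msubst_single)

lemma comm_ring_hom_Const: "comm_ring_hom (Const :: 'k::comm_ring_1 \<Rightarrow> 'k mpoly)"
  by unfold_locales (auto simp: Const_def single_add mult_single)

lemma comm_ring_hom_to_fract: "comm_ring_hom (to_fract :: 'a::idom \<Rightarrow> 'a fract)"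
  by unfold_locales auto

lemma comm_ring_hom_comp:
  "comm_ring_hom f \<Longrightarrow> comm_ring_hom g \<Longrightarrow> comm_ring_hom (\<lambda>x. f (g x))"
  unfolding comm_ring_hom_def ring_hom_def semiring_hom_def comm_monoid_add_hom_def
    monoid_add_hom_def zero_hom_def semigroup_add_hom_def plus_hom_def monoid_mult_hom_def
    one_hom_def semigroup_mult_hom_def times_hom_def
  by auto

text \<open>One new variable is split off per induction step. In this form a power of a monomial is
  visibly a substitution of powers.\<close>

lemma mpoly_single_eq:
  fixes c :: "'k::comm_ring_1"
  shows "Poly_Mapping.single m c = Const c * monom_val Var m"
proof (induction m arbitrary: c rule: update_induct)
  case const
  then show ?case by (simp add: Const_def)
next
  case (update f a b)
  have eq: "Poly_Mapping.update a b f = f + Poly_Mapping.single a b"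
    using update(1) by (intro poly_mapping_eqI)
      (auto simp: lookup_update lookup_add lookup_single in_keys_iff when_def)
  have pow: "Poly_Mapping.single (Poly_Mapping.single a n) 1 = (Var a :: 'k mpoly) ^ n" for n
  proof (induction n)
    case (Suc n)
    have "Poly_Mapping.single (Poly_Mapping.single a (Suc n)) (1 :: 'k) =
        Var a * Poly_Mapping.single (Poly_Mapping.single a n) 1"
      by (simp add: Var_def mult_single flip: single_add)
    then show ?case by (simp add: Suc)
  qed simp
  have "Poly_Mapping.single (f + Poly_Mapping.single a b) c =
      Poly_Mapping.single f c * Poly_Mapping.single (Poly_Mapping.single a b) 1"
    by (simp add: mult_single)
  then show ?case
    using update(3)[of c] by (simp add: eq monom_val_add mult.assoc pow)
qed

section \<open>Derivations\<close>

text \<open>Three derivations occur: d/dz_i on polynomials in z, its coefficientwise extension to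
  polynomials in t, and d/dt. The power and product rules are shared.\<close>

locale derivation =
  fixes D :: "'a::comm_ring_1 \<Rightarrow> 'a"
  assumes add: "D (x + y) = D x + D y"
    and mult: "D (x * y) = x * D y + D x * y"
begin

lemma zero [simp]: "D 0 = 0"
  using add[of 0 0] by simp

lemma one [simp]: "D 1 = 0"
  using mult[of 1 1] by simp

lemma diff: "D (x - y) = D x - D y"
  using add[of "x - y" y] by simp

lemma minus: "D (- x) = - D x"
  using diff[of 0 x] by simp

lemma sum: "D (\<Sum>a\<in>A. f a) = (\<Sum>a\<in>A. D (f a))"
  by (rule additive_sum) (auto simp: add)

lemma power: "D (x ^ n) = of_nat n * x ^ (n - 1) * D x"
proof (induction n)
  case (Suc n)
  then show ?case
    by (cases n) (auto simp: mult algebra_simps)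
qed auto

lemma prod: "D (\<Prod>a\<in>A. f a) = (\<Sum>a\<in>A. (\<Prod>b\<in>A - {a}. f b) * D (f a))"
proof (induction A rule: infinite_finite_induct)
  case (insert a A)
  have "(\<Prod>b\<in>insert a A - {c}. f b) = f a * (\<Prod>b\<in>A - {c}. f b)" if "c \<in> A" for c
    using insert that by (subst insert_Diff_if) auto
  then show ?case
    using insert by (auto simp: mult sum_distrib_left mult_ac)
qed auto

end

lemma derivation_pderiv_var: "derivation (pderiv_var i :: 'k::comm_ring_1 mpoly \<Rightarrow> 'k mpoly)"
proof -
  let ?e = "Poly_Mapping.single i 1 :: nat \<Rightarrow>\<^sub>0 nat"
  have superset: "pderiv_var i f = (\<Sum>m\<in>A. Poly_Mapping.single (m - ?e)
      (of_nat (Poly_Mapping.lookup m i) * Poly_Mapping.lookup f m))"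
    if "finite A" "Poly_Mapping.keys f \<subseteq> A" for f :: "'k mpoly" and A
    unfolding pderiv_var_def
    by (rule sum.mono_neutral_left) (use that in \<open>auto simp: in_keys_iff\<close>)
  have single: "pderiv_var i (Poly_Mapping.single m c) =
      Poly_Mapping.single (m - ?e) (of_nat (Poly_Mapping.lookup m i) * c)" for m and c :: 'k
    by (subst superset[of "{m}"]) auto
  have add: "pderiv_var i (f + g) = pderiv_var i f + pderiv_var i g" for f g :: "'k mpoly"
    using keys_add[of f g]
    by (subst (1 2 3) superset[of "Poly_Mapping.keys f \<union> Poly_Mapping.keys g"])
       (auto simp: lookup_add ring_distribs sum.distrib single_add)
  have zero: "pderiv_var i (0 :: 'k mpoly) = 0"
    by (simp add: pderiv_var_def)
  note sum = additive_sum[of "pderiv_var i :: 'k mpoly \<Rightarrow> _", OF zero add]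
  note expand = additive_expand[of "pderiv_var i :: 'k mpoly \<Rightarrow> _", OF zero add]
  have sub: "a + b - ?e = (a - ?e) + b" if "Poly_Mapping.lookup a i > 0" for a b :: "nat \<Rightarrow>\<^sub>0 nat"
    using that by (intro poly_mapping_eqI) (auto simp: lookup_add lookup_minus lookup_single when_def)
  \<comment> \<open>If z_i does not occur in \<open>a\<close>, truncated subtraction may give
    different monomials on the two sides, but the coefficient is then 0.\<close>
  have sub0: "Poly_Mapping.single (a + b - ?e) (of_nat (Poly_Mapping.lookup a i) * c) =
      Poly_Mapping.single ((a - ?e) + b) (of_nat (Poly_Mapping.lookup a i) * c)"
    for a b :: "nat \<Rightarrow>\<^sub>0 nat" and c :: 'k
    by (cases "Poly_Mapping.lookup a i > 0") (use sub[of a b] in auto)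
  have mono: "pderiv_var i (Poly_Mapping.single a c * Poly_Mapping.single b d) =
      Poly_Mapping.single a c * pderiv_var i (Poly_Mapping.single b d) +
      pderiv_var i (Poly_Mapping.single a c) * Poly_Mapping.single b d"
    for a b :: "nat \<Rightarrow>\<^sub>0 nat" and c d :: 'k
    using sub0[of a b "c * d"] sub0[of b a "c * d"]
    by (simp add: single mult_single lookup_add ring_distribs single_add add_ac mult_ac)
  have mult: "pderiv_var i (f * g) = f * pderiv_var i g + pderiv_var i f * g" for f g :: "'k mpoly"
  proof -
    let ?s = "\<lambda>f m. Poly_Mapping.single m (Poly_Mapping.lookup f m) :: 'k mpoly"
    let ?A = "Poly_Mapping.keys f" and ?B = "Poly_Mapping.keys g"
    have f: "f = (\<Sum>a\<in>?A. ?s f a)" and g: "g = (\<Sum>b\<in>?B. ?s g b)"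
      by (rule poly_mapping_eq_sum_single; simp)+
    have "pderiv_var i (f * g) = (\<Sum>a\<in>?A. \<Sum>b\<in>?B. ?s f a * pderiv_var i (?s g b)) +
        (\<Sum>a\<in>?A. \<Sum>b\<in>?B. pderiv_var i (?s f a) * ?s g b)"
      by (subst mpoly_mult_expand) (simp add: sum mono sum.distrib)
    also have "\<dots> = f * pderiv_var i g + pderiv_var i f * g"
      by (simp only: sum_product[symmetric] expand[of f, symmetric] expand[of g, symmetric]
          f[symmetric] g[symmetric])
    finally show ?thesis .
  qed
  show ?thesis by unfold_locales (auto simp: add mult)
qed

lemma pderiv_var_Var: "pderiv_var i (Var j :: 'k::comm_ring_1 mpoly) = (if i = j then 1 else 0)"
  by (auto simp: pderiv_var_def Var_def lookup_single)

lemma derivation_map_poly: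
  assumes "derivation D"
  shows "derivation (map_poly D)"
proof -
  interpret derivation D by fact
  show ?thesis
    by unfold_locales
       (auto intro!: poly_eqI simp: coeff_map_poly add coeff_mult sum mult sum.distrib)
qed

lemma derivation_pderiv: "derivation (pderiv :: 'a::idom poly \<Rightarrow> 'a poly)"
  by unfold_locales (auto simp: pderiv_add pderiv_mult)

section \<open>The ring \<open>\<F>\<^sub>p[z\<^sup>p]\<close>\<close>

text \<open>Carries the characteristic to polynomial rings, where the additivity of Frobenius and
  the vanishing of \<open>of_nat CARD('p)\<close> are needed.\<close>

lemma CHAR_mpoly [simp]: "CHAR('k::comm_ring_1 mpoly) = CHAR('k)"
proof (rule CHAR_eqI)
  have *: "(of_nat n :: 'k mpoly) = Poly_Mapping.single 0 (of_nat n)" for n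
    by simp
  show "(of_nat CHAR('k) :: 'k mpoly) = 0"
    unfolding * by (simp only: of_nat_CHAR single_zero)
  fix n assume "(of_nat n :: 'k mpoly) = 0"
  then have "(of_nat n :: 'k) = 0"
    unfolding * by (metis lookup_single_eq lookup_zero)
  then show "CHAR('k) dvd n"
    by (simp add: of_nat_eq_0_iff_char_dvd)
qed

section \<open>Frobenius as a substitution\<close>

lemma mod_ring_power_card [simp]: "(c :: 'p::prime_card mod_ring) ^ CARD('p) = c"
  using finite_field_power_card_eq_same[of c] by simp

lemma mod_ring_power_card_power [simp]: "(c :: 'p::prime_card mod_ring) ^ (CARD('p) ^ j) = c"
  by (induction j) (auto simp: power_mult mult.commute)

lemma Const_power: "Const (c :: 'k::comm_ring_1) ^ n = Const (c ^ n)"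
  by (induction n) (auto simp: Const_def mult_single)

lemma monom_val_power: "monom_val x m ^ n = monom_val (\<lambda>k. x k ^ n) m"
  by (simp add: monom_val_def prod_power_distrib power_mult[symmetric] mult.commute)

text \<open>Frobenius is additive, so the power acts on each monomial term separately, and it fixes
  the coefficients because c^p = c in F_p.\<close>

lemma msubst_Var_power:
  fixes f :: "'p::prime_card mod_ring mpoly"
  shows "msubst Const (\<lambda>k. Var k ^ (CARD('p) ^ j)) f = f ^ (CARD('p) ^ j)"
proof -
  have "f ^ (CARD('p) ^ j) =
      (\<Sum>m\<in>Poly_Mapping.keys f. Poly_Mapping.single m (Poly_Mapping.lookup f m)) ^ (CARD('p) ^ j)"
    using poly_mapping_eq_sum_single[of "Poly_Mapping.keys f" f] by simp
  also have "\<dots> = (\<Sum>m\<in>Poly_Mapping.keys f.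
      Poly_Mapping.single m (Poly_Mapping.lookup f m) ^ (CARD('p) ^ j))"
    by (rule freshmans_dream_sum') (auto simp: prime_card)
  also have "\<dots> = msubst Const (\<lambda>k. Var k ^ (CARD('p) ^ j)) f"
    by (simp add: msubst_def mpoly_single_eq power_mult_distrib monom_val_power Const_power
        flip: monom_val_def)
  finally show ?thesis ..
qed

section \<open>Closure properties of the polynomial rings\<close>

lemma polys_in_Const [intro]: "Const c \<in> polys_in V"
  by (auto simp: polys_in_def Const_def split: if_splits)

lemma polys_in_Var [intro]: "i \<in> V \<Longrightarrow> Var i \<in> polys_in V"
  by (auto simp: polys_in_def Var_def)

lemma polys_in_add [intro]: "f \<in> polys_in V \<Longrightarrow> g \<in> polys_in V \<Longrightarrow> f + g \<in> polys_in V"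
  unfolding polys_in_def using keys_add[of f g] by blast

lemma polys_in_mult [intro]:
  fixes f :: "'k::comm_ring_1 mpoly"
  assumes "f \<in> polys_in V" "g \<in> polys_in V"
  shows "f * g \<in> polys_in V"
proof -
  have "Poly_Mapping.keys m \<subseteq> V" if "m \<in> Poly_Mapping.keys (f * g)" for m
  proof -
    obtain a b where "m = a + b" "a \<in> Poly_Mapping.keys f" "b \<in> Poly_Mapping.keys g"
      using keys_mult[of f g] \<open>m \<in> _\<close> by blast
    then show ?thesis
      using assms keys_add[of a b] unfolding polys_in_def by blast
  qed
  then show ?thesis by (auto simp: polys_in_def)
qed

lemma polys_in_0 [intro, simp]: "0 \<in> polys_in V"
  by (auto simp: polys_in_def)

lemma polys_in_1 [intro, simp]: "1 \<in> polys_in V"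
  by (auto simp: polys_in_def)

lemma polys_in_of_nat [intro, simp]: "of_nat n \<in> polys_in V"
  by (induction n) auto

lemma polys_in_uminus [intro]: "f \<in> polys_in V \<Longrightarrow> - f \<in> polys_in V"
  for f :: "'k::comm_ring_1 mpoly"
  by (simp add: polys_in_def)

lemma polys_in_sum: "(\<And>a. a \<in> A \<Longrightarrow> f a \<in> polys_in V) \<Longrightarrow> (\<Sum>a\<in>A. f a) \<in> polys_in V"
  by (induction A rule: infinite_finite_induct) auto

lemma polys_in_power [intro]: "f \<in> polys_in V \<Longrightarrow> f ^ n \<in> polys_in V"
  for f :: "'k::comm_ring_1 mpoly"
  by (induction n) auto

text \<open>The case j = 1 of the Frobenius identity. Closure of this ring under sums and products
  then amounts to exhibiting a p-th root.\<close>

lemma Fp_zp_eq: "(Fp_zp g :: 'p::prime_card mod_ring mpoly set) =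
    (\<lambda>f. f ^ CARD('p)) ` polys_in {1..2*g+1}"
  using msubst_Var_power[where j = 1] by (auto simp: Fp_zp_def)

lemma Fp_zp_power:
  fixes f :: "'p::prime_card mod_ring mpoly"
  assumes "f \<in> polys_in {1..2*g+1}" "CARD('p) dvd n"
  shows "f ^ n \<in> Fp_zp g"
proof -
  obtain k where "n = k * CARD('p)" using assms(2) by (auto simp: mult.commute)
  then have "f ^ n = (f ^ k) ^ CARD('p)" by (simp add: power_mult)
  then show ?thesis using assms(1) by (auto simp: Fp_zp_eq)
qed

lemma Fp_zp_Const: "Const c \<in> (Fp_zp g :: 'p::prime_card mod_ring mpoly set)"
proof -
  have "Const c ^ CARD('p) \<in> (Fp_zp g :: 'p mod_ring mpoly set)"
    by (rule Fp_zp_power) auto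
  then show ?thesis by (simp add: Const_power)
qed

lemma Const_0: "Const 0 = 0"
  by (simp add: Const_def)

lemma Const_1: "Const 1 = 1"
  by (simp add: Const_def)

lemma Const_of_nat: "Const (of_nat n) = of_nat n"
  by (simp add: Const_def)

lemma Fp_zp_of_nat: "of_nat n \<in> (Fp_zp g :: 'p::prime_card mod_ring mpoly set)"
  using Fp_zp_Const[of "of_nat n" g] by (simp add: Const_of_nat)

lemma Fp_zp_0: "0 \<in> (Fp_zp g :: 'p::prime_card mod_ring mpoly set)"
  using Fp_zp_of_nat[of 0] by simp

lemma Fp_zp_1: "1 \<in> (Fp_zp g :: 'p::prime_card mod_ring mpoly set)"
  using Fp_zp_of_nat[of 1] by simp

lemma Fp_zp_add:
  assumes "a \<in> Fp_zp g" "b \<in> Fp_zp g"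
  shows "(a + b :: 'p::prime_card mod_ring mpoly) \<in> Fp_zp g"
proof -
  obtain f h where *: "f \<in> polys_in {1..2*g+1}" "a = f ^ CARD('p)"
    "h \<in> polys_in {1..2*g+1}" "b = h ^ CARD('p)"
    using assms by (auto simp: Fp_zp_eq)
  then have "a + b = (f + h) ^ CARD('p)"
    by (simp add: freshmans_dream prime_card)
  then show ?thesis using * by (auto simp: Fp_zp_eq)
qed

lemma Fp_zp_mult:
  assumes "a \<in> Fp_zp g" "b \<in> Fp_zp g"
  shows "(a * b :: 'p::prime_card mod_ring mpoly) \<in> Fp_zp g"
proof -
  obtain f h where *: "f \<in> polys_in {1..2*g+1}" "a = f ^ CARD('p)"
    "h \<in> polys_in {1..2*g+1}" "b = h ^ CARD('p)"
    using assms by (auto simp: Fp_zp_eq)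
  then have "a * b = (f * h) ^ CARD('p)"
    by (simp add: power_mult_distrib)
  then show ?thesis using * by (auto simp: Fp_zp_eq)
qed

lemma Fp_zp_sum: "(\<And>a. a \<in> A \<Longrightarrow> f a \<in> Fp_zp g) \<Longrightarrow> (\<Sum>a\<in>A. f a) \<in> Fp_zp g"
  by (induction A rule: infinite_finite_induct) (auto simp: Fp_zp_0 Fp_zp_add)

lemma Fp_zp_prod: "(\<And>a. a \<in> A \<Longrightarrow> f a \<in> Fp_zp g) \<Longrightarrow> (\<Prod>a\<in>A. f a) \<in> Fp_zp g"
  by (induction A rule: infinite_finite_induct) (auto simp: Fp_zp_1 Fp_zp_mult)

lemma Fp_zp_subset_polys_in: "c \<in> Fp_zp g \<Longrightarrow> c \<in> polys_in {1..2*g+1}"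
  by (auto simp: Fp_zp_eq)

text \<open>The derivative of f^p carries the factor p. So the scalars of the module are constants
  for every d/dz_i, and multiplying by them preserves the KZ equations.\<close>

lemma pderiv_var_Fp_zp:
  assumes "c \<in> (Fp_zp g :: 'p::prime_card mod_ring mpoly set)"
  shows "pderiv_var i c = 0"
proof -
  interpret derivation "pderiv_var i :: 'p mod_ring mpoly \<Rightarrow> _"
    by (rule derivation_pderiv_var)
  have "(of_nat CARD('p) :: 'p mod_ring mpoly) = 0"
    by (subst of_nat_eq_0_iff_char_dvd) simp
  then show ?thesis
    using assms by (auto simp: Fp_zp_eq power)
qed

section \<open>Shifting the variable of a polynomial\<close>

text \<open>The binomial theorem applied to each power of x + c. The bound \<open>d\<close> may be
  any number above the degree, so that a multiple of p can be chosen later.\<close>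

lemma coeff_pcompose_shift:
  fixes f :: "'a::comm_ring_1 poly"
  assumes "degree f < d"
  shows "coeff (pcompose f [:c, 1:]) n =
    (\<Sum>i<d. of_nat (i choose n) * c ^ (i - n) * coeff f i)"
proof -
  have mono: "pcompose (monom a i) r = smult a (r ^ i)" for a :: 'a and i r
    by (induction i) (auto simp: monom_Suc pcompose_pCons monom_0 pcompose_mult)
  have lin: "coeff ([:c, 1:] ^ i) n = of_nat (i choose n) * c ^ (i - n)" for i
  proof (cases "n \<le> i")
    case True
    then show ?thesis using coeff_linear_poly_power[of n i c 1] by simp
  next
    case False
    have "degree ([:c, 1:] ^ i) \<le> i"
      by (rule order.trans[OF degree_power_le]) simp
    then show ?thesis using False by (simp add: coeff_eq_0 binomial_eq_0)
  qed
  have "f = (\<Sum>i<d. monom (coeff f i) i)"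
  proof -
    obtain e where "d = Suc e" "degree f \<le> e"
      using assms by (cases d) auto
    then show ?thesis
      using poly_as_sum_of_monoms'[of f e] by (simp add: lessThan_Suc_atMost)
  qed
  then have "pcompose f [:c, 1:] = (\<Sum>i<d. smult (coeff f i) ([:c, 1:] ^ i))"
    by (metis (no_types, lifting) mono pcompose_sum sum.cong)
  then show ?thesis
    by (simp add: coeff_sum lin mult_ac)
qed

text \<open>The absorption identity \<open>(i + 1) (i choose n p - 1) = n p (i + 1 choose n p)\<close> leaves
  only the exponents congruent to \<open>-1\<close> modulo \<open>p\<close>.\<close>

lemma coeff_pcompose_shift_prime:
  fixes f :: "'a::comm_ring_1 poly"
  assumes "degree f < d * CHAR('a)" "prime CHAR('a)" "n > 0"
  shows "coeff (pcompose f [:c, 1:]) (n * CHAR('a) - 1) =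
    (\<Sum>k=1..d. of_nat ((k * CHAR('a) - 1) choose (n * CHAR('a) - 1)) *
       c ^ ((k - n) * CHAR('a)) * coeff f (k * CHAR('a) - 1))"
proof -
  let ?p = "CHAR('a)"
  let ?t = "\<lambda>i. of_nat (i choose (n * ?p - 1)) * c ^ (i - (n * ?p - 1)) * coeff f i"
  let ?K = "(\<lambda>k. k * ?p - 1) ` {1..d}"
  have p: "?p > 0" using assms(2) by (simp add: prime_gt_0_nat)
  have inj: "inj_on (\<lambda>k. k * ?p - 1) {1..d}"
  proof (rule inj_onI)
    fix x y assume "x \<in> {1..d}" "y \<in> {1..d}" "x * ?p - 1 = y * ?p - 1"
    moreover from this have "x * ?p > 0" "y * ?p > 0" using p by auto
    ultimately have "x * ?p = y * ?p" by linarith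
    then show "x = y" using p by simp
  qed
  have sub: "?K \<subseteq> {..<d * ?p}"
  proof safe
    fix k assume k: "k \<in> {1..d}"
    have "k * ?p > 0" "k * ?p \<le> d * ?p" using k p by auto
    then show "k * ?p - 1 < d * ?p" by linarith
  qed
  have zero: "?t i = 0" if i: "i \<in> {..<d * ?p} - ?K" for i
  proof -
    have ndvd: "\<not> ?p dvd Suc i"
    proof
      assume "?p dvd Suc i"
      then obtain k where k: "Suc i = k * ?p" by (metis dvdE mult.commute)
      then have "i = k * ?p - 1" by simp
      moreover have "k * ?p \<le> d * ?p" using i k by (simp add: Suc_le_eq flip: k)
      then have "k \<le> d" using p by simp
      moreover have "k \<ge> 1" using k by (cases k) auto
      ultimately show False using i by auto
    qed
    have "Suc (n * ?p - 1) = n * ?p"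
      using assms(3) p by simp
    then have "Suc i * (i choose (n * ?p - 1)) = (Suc i choose (n * ?p)) * (n * ?p)"
      using Suc_times_binomial_eq[of i "n * ?p - 1"] by simp
    then have "?p dvd Suc i * (i choose (n * ?p - 1))" by simp
    then have "?p dvd (i choose (n * ?p - 1))"
      using ndvd assms(2) prime_dvd_multD by blast
    then have "of_nat (i choose (n * ?p - 1)) = (0 :: 'a)"
      by (simp only: of_nat_eq_0_iff_char_dvd)
    then show ?thesis by (simp only: mult_zero_left)
  qed
  have "coeff (pcompose f [:c, 1:]) (n * ?p - 1) = (\<Sum>i<d * ?p. ?t i)"
    by (rule coeff_pcompose_shift) (rule assms(1))
  also have "\<dots> = (\<Sum>i\<in>?K. ?t i)"
    by (rule sum.mono_neutral_right) (use sub zero in auto)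
  also have "\<dots> = (\<Sum>k=1..d. ?t (k * ?p - 1))"
    by (subst sum.reindex[OF inj]) simp
  also have "\<dots> = (\<Sum>k=1..d. of_nat ((k * ?p - 1) choose (n * ?p - 1)) *
       c ^ ((k - n) * ?p) * coeff f (k * ?p - 1))"
  proof (rule sum.cong[OF refl], goal_cases)
    case (1 k)
    have "k * ?p > 0" "n * ?p > 0" using 1 p assms(3) by auto
    \<comment> \<open>For k < n both sides truncate to 0; the binomial coefficient in front is 0 in
      that case.\<close>
    then have "k * ?p - 1 - (n * ?p - 1) = (k - n) * ?p"
      by (simp add: diff_mult_distrib)
    then show ?case by simp
  qed
  finally show ?thesis .
qed

section \<open>The KZ equations\<close>

lemma Var_eq_iff [simp]: "Var i = (Var j :: 'k::zero_neq_one mpoly) \<longleftrightarrow> i = j"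
proof
  assume "Var i = (Var j :: 'k mpoly)"
  then have "Poly_Mapping.keys (Var i :: 'k mpoly) = Poly_Mapping.keys (Var j :: 'k mpoly)"
    by simp
  then have "Poly_Mapping.single i (1::nat) = Poly_Mapping.single j 1"
    by (simp add: Var_def)
  then have "Poly_Mapping.keys (Poly_Mapping.single i (1::nat)) =
      Poly_Mapping.keys (Poly_Mapping.single j (1::nat))"
    by simp
  then show "i = j" by simp
qed simp

text \<open>This is q = -1/2, written without division because it is applied in polynomial
  rings.\<close>

lemma two_of_nat_half:
  assumes "odd CHAR('a::comm_ring_1)"
  shows "2 * of_nat ((CHAR('a) - 1) div 2) = (-1 :: 'a)"
proof -
  have "2 * ((CHAR('a) - 1) div 2) + 1 = CHAR('a)"
    using assms by (auto elim: oddE)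
  then have "of_nat (2 * ((CHAR('a) - 1) div 2) + 1) = (0 :: 'a)"
    by (simp only: of_nat_CHAR)
  then show ?thesis by (simp add: eq_neg_iff_add_eq_0 add.commute)
qed

lemma two_neq_0:
  assumes "odd CHAR('a::comm_ring_1)"
  shows "(2 :: 'a) \<noteq> 0"
  using two_of_nat_half[OF assms] by auto

lemma Omega_mult_vec:
  fixes f :: "nat \<Rightarrow> 'a::comm_ring_1"
  assumes "finite A" "i \<in> A" "j \<in> A" "i \<noteq> j"
  shows "(\<Sum>l\<in>A. Omega i j k l * f l) =
    (if k = i then f j - f i else if k = j then f i - f j else 0)"
proof -
  have "(\<Sum>l\<in>A. Omega i j k l * f l) =
      (\<Sum>l\<in>A. (if l = i then (if k = i then - f i else if k = j then f i else 0) else 0) +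
        (if l = j then (if k = i then f j else if k = j then - f j else 0) else 0))"
    by (rule sum.cong) (use assms in \<open>auto simp: Omega_def\<close>)
  also have "\<dots> = (if k = i then f j - f i else if k = j then f i - f j else 0)"
    using assms by (auto simp: sum.distrib)
  finally show ?thesis .
qed

text \<open>The equation with \<open>k = i\<close> is the sum of the others, as the coordinates of \<open>F\<close> add up to 0.\<close>

lemma KZ_solutionI:
  fixes F :: "nat \<Rightarrow> 'k::field mpoly"
  assumes char: "odd CHAR('k)"
    and deriv: "\<And>i k. i \<in> {1..2*g+1} \<Longrightarrow> k \<in> {1..2*g+1} \<Longrightarrow> i \<noteq> k \<Longrightarrow>
      2 * (Var i - Var k) * pderiv_var i (F k) = F i - F k"
    and sum: "(\<Sum>k\<in>{1..2*g+1}. F k) = 0"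
  shows "KZ_solution g F"
  unfolding KZ_solution_def
proof (intro conjI ballI)
  let ?f = "to_fract :: 'k mpoly \<Rightarrow> _"
  define A where "A = {1..2*g+1}"
  fix i k assume "i \<in> {1..2*g+1}" "k \<in> {1..2*g+1}"
  then have i: "i \<in> A" and k: "k \<in> A" by (auto simp: A_def)
  have fin: "finite A" by (simp add: A_def)
  note sum' = sum[folded A_def] and deriv' = deriv[folded A_def]
  interpret d: derivation "pderiv_var i :: 'k mpoly \<Rightarrow> _"
    by (rule derivation_pderiv_var)
  have two: "(2 :: 'k mpoly fract) \<noteq> 0"
  proof -
    have "?f 2 \<noteq> 0" using two_neq_0[where 'a = "'k mpoly"] char by simp
    moreover have "?f 2 = 2" by (metis one_add_one to_fract_1 to_fract_add)
    ultimately show ?thesis by simp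
  qed
  have two': "?f 2 = 2" by (metis one_add_one to_fract_1 to_fract_add)
  have der: "?f (pderiv_var i (F k)) = 1 / 2 * (?f (F i - F k) / ?f (Var i - Var k))"
    if "k \<in> A" "k \<noteq> i" for k
  proof -
    have "?f (Var i - Var k) \<noteq> 0" using that by (simp del: to_fract_diff)
    moreover have "2 * ?f (Var i - Var k) * ?f (pderiv_var i (F k)) = ?f (F i - F k)"
      using deriv'[OF i \<open>k \<in> A\<close>] that two' by (metis to_fract_mult)
    ultimately show ?thesis using two by (simp add: field_simps del: to_fract_diff)
  qed
  have omega: "(\<Sum>l\<in>A. Omega i j k l * ?f (F l)) =
      (if k = i then ?f (F j - F i) else if k = j then ?f (F i - F j) else 0)"
    if "j \<in> A - {i}" for j
    using that i by (subst Omega_mult_vec[OF fin]) auto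
  have "(\<Sum>j\<in>A - {i}. (\<Sum>l\<in>A. Omega i j k l * ?f (F l)) / ?f (Var i - Var j)) =
     (\<Sum>j\<in>A - {i}. (if k = i then ?f (F j - F i) else if k = j then ?f (F i - F j) else 0) /
       ?f (Var i - Var j))" (is "?S = _")
    by (rule sum.cong[OF refl]) (simp only: omega)
  also have "1 / 2 * \<dots> = ?f (pderiv_var i (F k))"
  proof (cases "k = i")
    case True
    have "(\<Sum>k\<in>A. ?f (pderiv_var i (F k))) = ?f (pderiv_var i (\<Sum>k\<in>A. F k))"
      by (simp add: d.sum)
    also have "\<dots> = 0" by (subst sum') simp
    finally have "?f (pderiv_var i (F i)) = (\<Sum>k\<in>A - {i}. - ?f (pderiv_var i (F k)))"
      using i fin by (subst (asm) sum.remove[of _ i]) (auto simp: sum_negf eq_neg_iff_add_eq_0)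
    also have "\<dots> = (\<Sum>k\<in>A - {i}. 1 / 2 * (?f (F k - F i) / ?f (Var i - Var k)))"
      by (rule sum.cong[OF refl]) (auto simp: der minus_divide_left simp del: to_fract_diff
          simp flip: to_fract_uminus)
    finally show ?thesis using True by (simp add: sum_distrib_left)
  next
    case False
    have "(\<Sum>j\<in>A - {i}. (if k = i then ?f (F j - F i) else if k = j then ?f (F i - F j) else 0) /
        ?f (Var i - Var j)) = (\<Sum>j\<in>A - {i}. if j = k then ?f (F i - F k) / ?f (Var i - Var k) else 0)"
      by (rule sum.cong[OF refl]) (use False in auto)
    also have "\<dots> = ?f (F i - F k) / ?f (Var i - Var k)"
      using False k fin by simp
    finally show ?thesis using der[OF k False] by simp
  qed
  finally show "?f (pderiv_var i (F k)) = 1 / 2 *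
      (\<Sum>j\<in>{1..2*g+1} - {i}. (\<Sum>l\<in>{1..2*g+1}. Omega i j k l * ?f (F l)) / ?f (Var i - Var j))"
    by (simp only: A_def[symmetric])
qed (fact sum)

lemma linear_mult_cancel:
  fixes f h :: "'a::idom poly"
  shows "[:a, 1:] * f = [:a, 1:] * h \<Longrightarrow> f = h"
  using mult_left_cancel[of "[:a, 1:]" f h] by simp

lemma P_vec_eq:
  assumes "j \<in> {1..2*g+1}" "CARD('p::prime_card) \<ge> 3"
  shows "(P_vec g j :: 'p mod_ring mpoly poly) = [:- Var j, 1:] ^ ((CARD('p) - 1) div 2 - 1) *
    (\<Prod>a\<in>{1..2*g+1} - {j}. [:- Var a, 1:] ^ ((CARD('p) - 1) div 2))"
proof -
  let ?q = "(CARD('p) - 1) div 2"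
  have q: "?q = Suc (?q - 1)" using assms(2) by simp
  have "Phi g = [:- Var j, 1:] ^ ?q * (\<Prod>a\<in>{1..2*g+1} - {j}. [:- Var a, 1 :: 'p mod_ring mpoly:] ^ ?q)"
    unfolding Phi_def using assms(1) by (subst prod.remove[of _ j]) auto
  also have "[:- Var j, 1 :: 'p mod_ring mpoly:] ^ ?q = [:- Var j, 1:] * [:- Var j, 1:] ^ (?q - 1)"
    by (subst q) simp
  finally have "[:- Var j, 1:] * P_vec g j = [:- Var j, 1 :: 'p mod_ring mpoly:] *
      ([:- Var j, 1:] ^ (?q - 1) * (\<Prod>a\<in>{1..2*g+1} - {j}. [:- Var a, 1:] ^ ?q))"
    using P_vec_exact[OF assms] by (simp only: mult.assoc)
  then show ?thesis by (rule linear_mult_cancel)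
qed

text \<open>The logarithmic derivative of Phi without fractions: P_a stands for Phi / (t - z_a). It
  is applied both to d/dt and to d/dz_i.\<close>

lemma derivation_Phi:
  fixes D :: "'p::prime_card mod_ring mpoly poly \<Rightarrow> 'p mod_ring mpoly poly"
  assumes "derivation D" "CARD('p) \<ge> 3"
  shows "D (Phi g) = of_nat ((CARD('p) - 1) div 2) *
    (\<Sum>a\<in>{1..2*g+1}. P_vec g a * D [:- Var a, 1:])"
proof -
  interpret derivation D by fact
  show ?thesis
    unfolding Phi_def prod power sum_distrib_left
    by (rule sum.cong[OF refl], subst P_vec_eq) (use assms(2) in \<open>simp_all only: mult_ac\<close>)
qed

lemma odd_CARD:
  assumes "CARD('p::prime_card) \<ge> 3"
  shows "odd CARD('p)"
  using prime_odd_nat[OF prime_card] assms by force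

text \<open>Here the choice of the exponents np-1 matters: such a coefficient of dPhi/dt is np times
  a coefficient of Phi, hence 0.\<close>

lemma sum_coeff_P_vec:
  assumes "CARD('p::prime_card) \<ge> 3" "n > 0"
  shows "(\<Sum>k\<in>{1..2*g+1}. coeff (P_vec g k :: 'p mod_ring mpoly poly) (n * CARD('p) - 1)) = 0"
proof -
  let ?S = "\<Sum>k\<in>{1..2*g+1}. P_vec g k :: 'p mod_ring mpoly poly"
  have "2 * pderiv (Phi g) = 2 * of_nat ((CARD('p) - 1) div 2) * ?S"
    using derivation_Phi[OF derivation_pderiv assms(1), of g]
    by (simp add: mult.assoc pderiv_pCons one_pCons[symmetric])
  also have "2 * of_nat ((CARD('p) - 1) div 2) = (-1 :: 'p mod_ring mpoly poly)"
    using two_of_nat_half[where 'a = "'p mod_ring mpoly poly"] odd_CARD[OF assms(1)] by simp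
  finally have "?S = - 2 * pderiv (Phi g)" by simp
  moreover have "Suc (n * CARD('p) - 1) = n * CARD('p)" using assms(2) by simp
  moreover have "of_nat (n * CARD('p)) = (0 :: 'p mod_ring mpoly)"
    by (subst of_nat_eq_0_iff_char_dvd) simp
  ultimately have "coeff ?S (n * CARD('p) - 1) = 0"
    by (simp only: coeff_pderiv mult_minus_left coeff_minus mult_zero_left minus_zero
        mult_2 coeff_add add_0_right)
  then show ?thesis by (simp add: coeff_sum)
qed

text \<open>Write D for d/dz_i. From 2 D Phi = P_i and Phi = (t - z_k) P_k follows (t - z_k) 2 D P_k
  = P_i. Multiply by z_i - z_k = (t - z_k) - (t - z_i), use (t - z_i) P_i = (t - z_k) P_k, and
  cancel t - z_k. The result is free of t outside the P's, so it holds for each coefficient.\<close>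

lemma pderiv_var_coeff_P_vec:
  assumes "CARD('p::prime_card) \<ge> 3" "i \<in> {1..2*g+1}" "k \<in> {1..2*g+1}" "i \<noteq> k"
  shows "2 * (Var i - Var k) * pderiv_var i (coeff (P_vec g k :: 'p mod_ring mpoly poly) n) =
    coeff (P_vec g i) n - coeff (P_vec g k) n"
proof -
  let ?D = "map_poly (pderiv_var i) :: 'p mod_ring mpoly poly \<Rightarrow> _"
  let ?P = "P_vec g :: nat \<Rightarrow> 'p mod_ring mpoly poly"
  let ?x = "\<lambda>a. [:- Var a, 1 :: 'p mod_ring mpoly:]"
  interpret d: derivation "pderiv_var i :: 'p mod_ring mpoly \<Rightarrow> _"
    by (rule derivation_pderiv_var)
  interpret D: derivation ?D
    by (rule derivation_map_poly) (rule derivation_pderiv_var)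
  have D_lin: "?D (?x a) = (if a = i then -1 else 0)" for a
    by (rule poly_eqI) (auto simp: coeff_map_poly coeff_pCons d.minus pderiv_var_Var
        one_pCons split: nat.splits)
  have "2 * ?D (Phi g) = 2 * of_nat ((CARD('p) - 1) div 2) * (\<Sum>a\<in>{1..2*g+1}. ?P a * ?D (?x a))"
    using derivation_Phi[OF D.derivation_axioms assms(1), of g] by (simp add: mult.assoc)
  also have "2 * of_nat ((CARD('p) - 1) div 2) = (-1 :: 'p mod_ring mpoly poly)"
    using two_of_nat_half[where 'a = "'p mod_ring mpoly poly"] odd_CARD[OF assms(1)] by simp
  also have "(\<Sum>a\<in>{1..2*g+1}. ?P a * ?D (?x a)) = (\<Sum>a\<in>{1..2*g+1}. if a = i then - ?P a else 0)"
    by (rule sum.cong) (auto simp: D_lin)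
  also have "\<dots> = - ?P i" using assms(2) by simp
  finally have "2 * ?D (Phi g) = ?P i" by simp
  moreover have "?D (Phi g) = ?x k * ?D (?P k)"
    using P_vec_exact[OF assms(3,1)] D.mult[of "?x k" "?P k"] D_lin[of k] assms(4) by simp
  ultimately have 1: "?x k * (2 * ?D (?P k)) = ?P i" by (simp add: mult_ac)
  have 2: "?x i * ?P i = ?x k * ?P k"
    using P_vec_exact[OF assms(2,1)] P_vec_exact[OF assms(3,1)] by simp
  have "?x k * ([:Var i - Var k:] * (2 * ?D (?P k))) = [:Var i - Var k:] * ?P i"
    by (subst 1[symmetric]) (simp add: mult_ac)
  also have eq: "[:Var i - Var k:] = ?x k - ?x i" by simp
  also have "(?x k - ?x i) * ?P i = ?x k * (?P i - ?P k)"
    using 2 by (simp only: left_diff_distrib right_diff_distrib)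
  finally have "[:Var i - Var k:] * (2 * ?D (?P k)) = ?P i - ?P k"
    unfolding eq by (rule linear_mult_cancel)
  then have "coeff (?P i - ?P k) n = coeff ([:Var i - Var k:] * (?D (?P k) + ?D (?P k))) n"
    by (simp only: mult_2)
  also have "\<dots> = (Var i - Var k) * (coeff (?D (?P k)) n + coeff (?D (?P k)) n)"
    by (simp only: mult_pCons_left mult_zero_left pCons_0_0 add_0_right coeff_smult coeff_add)
  also have "\<dots> = 2 * (Var i - Var k) * pderiv_var i (coeff (?P k) n)"
    by (simp only: coeff_map_poly[of "pderiv_var i", OF d.zero] mult_2[symmetric] mult.assoc mult.left_commute)
  finally show ?thesis by (simp only: coeff_diff)
qed

text \<open>The conditions of \<open>KZ_solutionI\<close> are linear over scalars with zero
  derivative, so they pass from the coefficients of P to the module. For m < g the number g - m is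
  positive, as \<open>sum_coeff_P_vec\<close> requires.\<close>

lemma KZ_solution_M_module:
  assumes "CARD('p::prime_card) \<ge> 3" "F \<in> (M_module g :: (nat \<Rightarrow> 'p mod_ring mpoly) set)"
  shows "KZ_solution g F"
proof -
  obtain c where F: "F = (\<lambda>i. \<Sum>m<g. c m * I_vec g m i)" and c: "\<And>m. m < g \<Longrightarrow> c m \<in> Fp_zp g"
    using assms(2) by (auto simp: M_module_def)
  show ?thesis
  proof (rule KZ_solutionI)
    show "odd CHAR('p mod_ring)" using odd_CARD[OF assms(1)] by simp
  next
    fix i k assume ik: "i \<in> {1..2*g+1}" "k \<in> {1..2*g+1}" "i \<noteq> k"
    interpret d: derivation "pderiv_var i :: 'p mod_ring mpoly \<Rightarrow> _"
      by (rule derivation_pderiv_var)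
    have "pderiv_var i (F k) = (\<Sum>m<g. c m * pderiv_var i (I_vec g m k))"
      unfolding F d.sum d.mult
      by (rule sum.cong[OF refl]) (use c pderiv_var_Fp_zp in auto)
    then have "2 * (Var i - Var k) * pderiv_var i (F k) =
        (\<Sum>m<g. c m * (2 * (Var i - Var k) * pderiv_var i (I_vec g m k)))"
      by (simp only: sum_distrib_left mult_ac)
    also have "\<dots> = (\<Sum>m<g. c m * (I_vec g m i - I_vec g m k))"
      using pderiv_var_coeff_P_vec[OF assms(1) ik] ik by (simp add: I_vec_def)
    finally show "2 * (Var i - Var k) * pderiv_var i (F k) = F i - F k"
      by (simp add: F right_diff_distrib sum_subtractf)
  next
    have "(\<Sum>k\<in>{1..2*g+1}. F k) = (\<Sum>m<g. c m * (\<Sum>k\<in>{1..2*g+1}. I_vec g m k))"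
      unfolding F by (subst sum.swap) (simp only: sum_distrib_left)
    also have "\<dots> = (\<Sum>m<g. c m * 0)"
    proof (rule sum.cong[OF refl], goal_cases)
      case (1 m)
      then show ?case
        using sum_coeff_P_vec[OF assms(1), of "g - m" g] by (simp add: I_vec_def)
    qed
    finally show "(\<Sum>k\<in>{1..2*g+1}. F k) = 0" by simp
  qed
qed

section \<open>Coefficients of products of powers of linear factors\<close>

text \<open>The exponents that can occur in a product of (x - lambda_i)^(e i) with all e i <= q.
  \<open>Delta\<close> is the part of it cut out by bounds on the total degree.\<close>

definition exponent_box :: "nat \<Rightarrow> nat set \<Rightarrow> (nat \<Rightarrow>\<^sub>0 nat) set" where
  "exponent_box q I = {l. Poly_Mapping.keys l \<subseteq> I \<and> (\<forall>i\<in>I. Poly_Mapping.lookup l i \<le> q)}"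

lemma exponent_box_iff:
  "l \<in> exponent_box q I \<longleftrightarrow>
    (\<forall>i\<in>I. Poly_Mapping.lookup l i \<le> q) \<and> (\<forall>i. i \<notin> I \<longrightarrow> Poly_Mapping.lookup l i = 0)"
  by (auto simp: exponent_box_def in_keys_iff)

lemma exponent_box_empty [simp]: "exponent_box q {} = {0}"
  by (auto simp: exponent_box_iff intro: poly_mapping_eqI)

lemma exponent_box_insert:
  assumes "i \<notin> I"
  shows "bij_betw (\<lambda>(k, l). Poly_Mapping.single i k + l) ({..q} \<times> exponent_box q I)
    (exponent_box q (insert i I))"
proof (rule bij_betw_byWitness[where f' = "\<lambda>l. (Poly_Mapping.lookup l i, Poly_Mapping.update i 0 l)"],
    goal_cases)
  case 1
  have "Poly_Mapping.lookup l i = 0" if "l \<in> exponent_box q I" for l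
    using that assms by (simp add: exponent_box_iff)
  then show ?case
    by (auto simp: lookup_add lookup_single lookup_update when_def intro!: poly_mapping_eqI)
next
  case 2
  then show ?case
    by (auto simp: lookup_add lookup_single lookup_update when_def intro!: poly_mapping_eqI)
next
  case 3
  then show ?case
    using assms by (auto simp: exponent_box_iff lookup_add lookup_single when_def)
next
  case 4
  then show ?case
    using assms by (auto simp: exponent_box_iff lookup_update)
qed

lemma finite_exponent_box: "finite I \<Longrightarrow> finite (exponent_box q I)"
proof (induction I rule: finite_induct)
  case (insert i I)
  then show ?case
    using bij_betw_finite[OF exponent_box_insert[of i I q]] by simp
qed simp

text \<open>The sum runs to a common bound \<open>q\<close> instead of \<open>e\<close>, so that
  factors with exponents q and q-1 share one index set; the extra binomial coefficients are
  0.\<close>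

lemma linear_power_expand:
  assumes "e \<le> q"
  shows "[:- Var i, 1 :: 'k::comm_ring_1 mpoly:] ^ e =
    (\<Sum>k\<le>q. monom (Poly_Mapping.single (Poly_Mapping.single i k) ((-1) ^ k * of_nat (e choose k))) (e - k))"
proof -
  have neg: "(- Var i :: 'k mpoly) ^ k = Poly_Mapping.single (Poly_Mapping.single i k) ((-1) ^ k)" for k
  proof (induction k)
    case (Suc k)
    then show ?case
      by (simp add: Var_def mult_single single_uminus[symmetric] flip: single_add)
  qed simp
  have of_nat: "Poly_Mapping.single l c * of_nat N = Poly_Mapping.single l (c * of_nat N)"
    for N l and c :: 'k
    by (simp add: mult_single flip: single_of_nat)
  have "[:- Var i, 1 :: 'k mpoly:] ^ e = ([:- Var i:] + monom 1 1) ^ e"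
    by (simp add: monom_Suc monom_0)
  also have "\<dots> = (\<Sum>k\<le>e. of_nat (e choose k) * [:- Var i:] ^ k * monom 1 1 ^ (e - k))"
    by (rule binomial_ring)
  also have "\<dots> = (\<Sum>k\<le>e. monom (Poly_Mapping.single (Poly_Mapping.single i k)
      ((-1) ^ k * of_nat (e choose k))) (e - k))"
    by (rule sum.cong[OF refl])
       (simp add: poly_const_pow monom_power neg of_nat of_nat_mult_conv_smult smult_monom
         mult_smult_left mult.commute[of "of_nat _"])
  also have "\<dots> = (\<Sum>k\<le>q. monom (Poly_Mapping.single (Poly_Mapping.single i k)
      ((-1) ^ k * of_nat (e choose k))) (e - k))"
    by (rule sum.mono_neutral_left) (use assms in \<open>auto simp: binomial_eq_0\<close>)
  finally show ?thesis .
qed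

lemma prod_linear_power_expand:
  assumes "finite I" "\<And>i. i \<in> I \<Longrightarrow> e i \<le> q"
  shows "(\<Prod>i\<in>I. [:- Var i, 1 :: 'k::comm_ring_1 mpoly:] ^ e i) = (\<Sum>l\<in>exponent_box q I.
    monom (Poly_Mapping.single l (\<Prod>i\<in>I. (-1) ^ Poly_Mapping.lookup l i *
        of_nat (e i choose Poly_Mapping.lookup l i)))
      (\<Sum>i\<in>I. e i - Poly_Mapping.lookup l i))"
  using assms
proof (induction I rule: finite_induct)
  case empty
  then show ?case by (simp add: monom_0)
next
  case (insert a I)
  let ?c = "\<lambda>I l. (\<Prod>i\<in>I. (-1) ^ Poly_Mapping.lookup l i *
        of_nat (e i choose Poly_Mapping.lookup l i)) :: 'k"
  let ?E = "\<lambda>I l. \<Sum>i\<in>I. e i - Poly_Mapping.lookup l i"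
  let ?T = "\<lambda>I l. monom (Poly_Mapping.single l (?c I l)) (?E I l) :: 'k mpoly poly"
  have "(\<Prod>i\<in>insert a I. [:- Var i, 1 :: 'k mpoly:] ^ e i) =
      (\<Sum>k\<le>q. monom (Poly_Mapping.single (Poly_Mapping.single a k) ((-1) ^ k * of_nat (e a choose k))) (e a - k))
      * (\<Sum>l\<in>exponent_box q I. ?T I l)"
    using insert by (subst prod.insert) (auto simp: linear_power_expand[of "e a" q])
  also have "\<dots> = (\<Sum>(k, l)\<in>{..q} \<times> exponent_box q I.
      monom (Poly_Mapping.single (Poly_Mapping.single a k) ((-1) ^ k * of_nat (e a choose k))) (e a - k) * ?T I l)"
    by (simp add: sum_product sum.cartesian_product)
  also have "\<dots> = (\<Sum>(k, l)\<in>{..q} \<times> exponent_box q I. ?T (insert a I) (Poly_Mapping.single a k + l))"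
  proof (rule sum.cong[OF refl], safe)
    fix k l assume l: "l \<in> exponent_box q I"
    let ?l = "Poly_Mapping.single a k + l"
    have la: "Poly_Mapping.lookup ?l a = k"
      using l insert(2) by (auto simp: exponent_box_iff lookup_add)
    have li: "Poly_Mapping.lookup ?l i = Poly_Mapping.lookup l i" if "i \<in> I" for i
      using that insert(2) by (auto simp: lookup_add lookup_single when_def)
    have "?c (insert a I) ?l = (-1) ^ k * of_nat (e a choose k) * ?c I l"
      using insert(1,2) by (simp add: la li)
    moreover have "?E (insert a I) ?l = (e a - k) + ?E I l"
      using insert(1,2) by (simp add: la li)
    ultimately show "monom (Poly_Mapping.single (Poly_Mapping.single a k)
        ((-1) ^ k * of_nat (e a choose k))) (e a - k) * ?T I l = ?T (insert a I) ?l"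
      by (simp only: mult_monom mult_single)
  qed
  also have "\<dots> = (\<Sum>l\<in>exponent_box q (insert a I). ?T (insert a I) l)"
    using sum.reindex_bij_betw[OF exponent_box_insert[OF insert(2), of q], of "?T (insert a I)"]
    by (simp add: case_prod_beta)
  finally show ?case .
qed

text \<open>Otherwise simplification would split off the last index of the ranges ending in
  2g+1.\<close>

declare sum.cl_ivl_Suc [simp del] prod.cl_ivl_Suc [simp del]

section \<open>The vectors \<open>K\<^sup>m\<close> as coefficients\<close>

text \<open>The exponent of t - z_i in P_j.\<close>

definition P_exp :: "nat \<Rightarrow> nat \<Rightarrow> nat \<Rightarrow> nat" where
  "P_exp q j i = (if i = j then q - 1 else q)"

text \<open>The points z_i after normalization: 0, 1, lambda_3, and so on.\<close>

definition norm_roots :: "nat \<Rightarrow> 'k::comm_ring_1 mpoly" where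
  "norm_roots i = (if i = 1 then 0 else if i = 2 then 1 else Var i)"

text \<open>Over the integers q (q-1 choose k) = (q-k) (q choose k); doubling and inserting 2q = -1
  gives the factor 2k+1. This is the origin of the entries 2 l_i + 1 of K^m.\<close>

lemma of_nat_choose_pred_half:
  assumes "CARD('p::prime_card) = 2 * q + 1" "q \<ge> 1" "k \<le> q"
  shows "(of_nat (q - 1 choose k) :: 'p mod_ring) = (2 * of_nat k + 1) * of_nat (q choose k)"
proof -
  have "2 * of_nat q + 1 = (0 :: 'p mod_ring)"
    using of_nat_card_eq_0[where 'a = 'p] by (simp add: assms(1) add.commute)
  then have q: "2 * of_nat q = (- 1 :: 'p mod_ring)"
    by (simp add: eq_neg_iff_add_eq_0)
  have "q * (q - 1 choose k) = (q - k) * (q choose k)"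
    using binomial_absorb_comp[of q k] by simp
  then have "of_nat q * of_nat (q - 1 choose k) = (of_nat q - of_nat k) * (of_nat (q choose k) :: 'p mod_ring)"
    using assms(3) by (metis of_nat_diff of_nat_mult)
  then have "2 * of_nat q * of_nat (q - 1 choose k) =
      (2 * of_nat q - 2 * of_nat k) * (of_nat (q choose k) :: 'p mod_ring)"
    by (simp only: mult.assoc right_diff_distrib[symmetric])
  then show ?thesis unfolding q by (simp add: algebra_simps)
qed

text \<open>From k (q choose k) = q (q-1 choose k-1) and 2q = -1. This is the origin of the second
  entry of K^m.\<close>

lemma of_nat_choose_pred_pred_half:
  assumes "CARD('p::prime_card) = 2 * q + 1" "q \<ge> 1" "k \<ge> 1"
  shows "(of_nat (q - 1 choose (k - 1)) :: 'p mod_ring) = - 2 * of_nat k * of_nat (q choose k)"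
proof -
  have "2 * of_nat q + 1 = (0 :: 'p mod_ring)"
    using of_nat_card_eq_0[where 'a = 'p] by (simp add: assms(1) add.commute)
  then have q: "2 * of_nat q = (- 1 :: 'p mod_ring)"
    by (simp add: eq_neg_iff_add_eq_0)
  have "k * (q choose k) = q * (q - 1 choose (k - 1))"
    using times_binomial_minus1_eq[of k q] assms(3) by simp
  then have "of_nat k * of_nat (q choose k) = (of_nat q * of_nat (q - 1 choose (k - 1)) :: 'p mod_ring)"
    by (metis of_nat_mult)
  then have "2 * of_nat k * of_nat (q choose k) = (2 * of_nat q * of_nat (q - 1 choose (k - 1)) :: 'p mod_ring)"
    by (simp add: mult.assoc)
  then show ?thesis unfolding q by simp
qed

text \<open>The roots 0 and 1 contribute x^(e 1) and (x - 1)^(e 2). Once the exponents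
  \<open>l\<close> of the other roots are chosen, the power of x taken from (x - 1)^(e 2) is forced;
  the test guards the truncated subtraction computing it.\<close>

lemma coeff_prod_norm_roots:
  fixes e :: "nat \<Rightarrow> nat"
  assumes "g \<ge> 1" "\<And>i. e i \<le> q"
  shows "coeff (\<Prod>a\<in>{1..2*g+1}. [:- norm_roots a, 1 :: 'k::comm_ring_1 mpoly:] ^ e a) n =
    (\<Sum>l\<in>exponent_box q {3..2*g+1}. Poly_Mapping.single l
      (if (\<Sum>i\<in>{3..2*g+1}. e i - Poly_Mapping.lookup l i) + e 1 \<le> n then
        (\<Prod>i\<in>{3..2*g+1}. (-1) ^ Poly_Mapping.lookup l i * of_nat (e i choose Poly_Mapping.lookup l i)) *
        (of_nat (e 2 choose (n - (\<Sum>i\<in>{3..2*g+1}. e i - Poly_Mapping.lookup l i) - e 1)) *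
        (-1) ^ (e 2 - (n - (\<Sum>i\<in>{3..2*g+1}. e i - Poly_Mapping.lookup l i) - e 1)))
       else 0))"
proof -
  let ?I = "{3..2*g+1}"
  let ?c = "\<lambda>l. \<Prod>i\<in>?I. (-1) ^ Poly_Mapping.lookup l i * of_nat (e i choose Poly_Mapping.lookup l i) :: 'k"
  let ?E = "\<lambda>l. \<Sum>i\<in>?I. e i - Poly_Mapping.lookup l i"
  let ?x = "\<lambda>a. [:- norm_roots a, 1 :: 'k mpoly:]"
  have lin: "coeff ([:- 1, 1 :: 'k mpoly:] ^ e 2) u =
      Poly_Mapping.single 0 (of_nat (e 2 choose u) * (-1) ^ (e 2 - u))" for u
  proof (cases "u \<le> e 2")
    case True
    have "(-1 :: 'k mpoly) ^ k = Poly_Mapping.single 0 ((-1) ^ k)" for k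
      by (induction k) (auto simp: mult_single single_uminus)
    then show ?thesis
      using True coeff_linear_poly_power[of u "e 2" "-1 :: 'k mpoly" 1]
      by (simp add: mult_single flip: single_of_nat)
  next
    case False
    have "degree ([:- 1, 1 :: 'k mpoly:] ^ e 2) \<le> e 2"
      by (rule order.trans[OF degree_power_le]) simp
    then show ?thesis using False by (simp add: coeff_eq_0 binomial_eq_0)
  qed
  have set: "{1..2*g+1} = insert 1 (insert 2 ?I)" using assms(1) by auto
  have "(\<Prod>a\<in>{1..2*g+1}. ?x a ^ e a) = ?x 1 ^ e 1 * (?x 2 ^ e 2 * (\<Prod>a\<in>?I. ?x a ^ e a))"
    unfolding set by (subst prod.insert; simp)+
  also have "?x 1 ^ e 1 = monom 1 (e 1)"
    by (simp add: norm_roots_def monom_altdef)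
  also have "?x 2 = [:- 1, 1:]"
    by (simp add: norm_roots_def)
  also have "(\<Prod>a\<in>?I. ?x a ^ e a) = (\<Prod>a\<in>?I. [:- Var a, 1:] ^ e a)"
    by (rule prod.cong) (auto simp: norm_roots_def)
  also have "\<dots> = (\<Sum>l\<in>exponent_box q ?I. monom (Poly_Mapping.single l (?c l)) (?E l))"
    by (rule prod_linear_power_expand) (use assms(2) in auto)
  also have "monom 1 (e 1) * ([:- 1, 1:] ^ e 2 *
        (\<Sum>l\<in>exponent_box q ?I. monom (Poly_Mapping.single l (?c l)) (?E l))) =
      (\<Sum>l\<in>exponent_box q ?I. monom (Poly_Mapping.single l (?c l)) (?E l + e 1) * [:- 1, 1:] ^ e 2)"
    unfolding sum_distrib_left
  proof (rule sum.cong[OF refl], goal_cases)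
    case (1 l)
    have "monom (Poly_Mapping.single l (?c l)) (?E l + e 1) =
        monom 1 (e 1) * monom (Poly_Mapping.single l (?c l)) (?E l)"
      by (simp add: mult_monom add.commute)
    then show ?case by (simp only: mult_ac)
  qed
  finally show ?thesis
    by (simp add: coeff_sum coeff_monom_mult lin mult_single if_distrib[of "Poly_Mapping.single _"]
        cong: if_cong)
qed

text \<open>The degree count for P_j, written additively so that linear arithmetic can use it
  without truncated subtraction.\<close>

lemma sum_P_exp:
  assumes "g \<ge> 1" "q \<ge> 1" "j \<in> {1..2*g+1}"
  shows "P_exp q j 1 + P_exp q j 2 + (\<Sum>i\<in>{3..2*g+1}. P_exp q j i) + 1 = (2 * g + 1) * q"
proof -
  have set: "{1..2*g+1} = insert 1 (insert 2 {3..2*g+1})" using assms(1) by auto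
  have "(\<Sum>i\<in>{1..2*g+1}. P_exp q j i) = P_exp q j j + (\<Sum>i\<in>{1..2*g+1} - {j}. P_exp q j i)"
    using assms(3) by (intro sum.remove) auto
  also have "(\<Sum>i\<in>{1..2*g+1} - {j}. P_exp q j i) = (\<Sum>i\<in>{1..2*g+1} - {j}. q)"
    by (rule sum.cong) (auto simp: P_exp_def)
  also have "\<dots> = 2 * g * q" using assms(3) by simp
  finally have "(\<Sum>i\<in>{1..2*g+1}. P_exp q j i) + 1 = (2 * g + 1) * q"
    using assms(2) by (simp add: P_exp_def)
  moreover have "(\<Sum>i\<in>{1..2*g+1}. P_exp q j i) =
      P_exp q j 1 + P_exp q j 2 + (\<Sum>i\<in>{3..2*g+1}. P_exp q j i)"
    unfolding set by simp
  ultimately show ?thesis by simp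
qed

lemma prod_choose_P_exp:
  assumes p: "CARD('p::prime_card) = 2 * q + 1" and q: "q \<ge> 1"
    and l: "l \<in> exponent_box q {3..2*g+1}"
  shows "(\<Prod>i\<in>{3..2*g+1}. of_nat (P_exp q j i choose Poly_Mapping.lookup l i) :: 'p mod_ring) =
    (if j \<in> {3..2*g+1} then 2 * of_nat (Poly_Mapping.lookup l j) + 1 else 1) *
    (\<Prod>i\<in>{3..2*g+1}. of_nat (q choose Poly_Mapping.lookup l i))"
proof (cases "j \<in> {3..2*g+1}")
  case True
  have "(\<Prod>i\<in>{3..2*g+1}. of_nat (P_exp q j i choose Poly_Mapping.lookup l i) :: 'p mod_ring) =
      of_nat (q - 1 choose Poly_Mapping.lookup l j) *
      (\<Prod>i\<in>{3..2*g+1} - {j}. of_nat (P_exp q j i choose Poly_Mapping.lookup l i))"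
    using True by (subst prod.remove[of _ j]) (auto simp: P_exp_def)
  also have "(\<Prod>i\<in>{3..2*g+1} - {j}. of_nat (P_exp q j i choose Poly_Mapping.lookup l i)) =
      (\<Prod>i\<in>{3..2*g+1} - {j}. of_nat (q choose Poly_Mapping.lookup l i) :: 'p mod_ring)"
    by (rule prod.cong) (auto simp: P_exp_def)
  also have "of_nat (q - 1 choose Poly_Mapping.lookup l j) =
      (2 * of_nat (Poly_Mapping.lookup l j) + 1) * (of_nat (q choose Poly_Mapping.lookup l j) :: 'p mod_ring)"
    using l True by (intro of_nat_choose_pred_half[OF p q]) (auto simp: exponent_box_iff)
  finally show ?thesis
    using True by (subst (2) prod.remove[of _ j]) (auto simp: mult.assoc)
next
  case False
  have "(\<Prod>i\<in>{3..2*g+1}. of_nat (P_exp q j i choose Poly_Mapping.lookup l i) :: 'p mod_ring) =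
      (\<Prod>i\<in>{3..2*g+1}. of_nat (q choose Poly_Mapping.lookup l i))"
    by (rule prod.cong) (use False in \<open>auto simp: P_exp_def\<close>)
  then show ?thesis by (simp only: False if_False mult_1_left)
qed

lemma Delta_iff:
  assumes "p = 2 * q + 1"
  shows "l \<in> Delta p g m g \<longleftrightarrow> l \<in> exponent_box q {3..2*g+1} \<and>
    m * p \<le> sum_l g l + g \<and> sum_l g l + g \<le> m * p + q"
proof -
  have p: "(int p - 1) div 2 = int q" "(p - 1) div 2 = q"
    using assms by auto
  have "(0 \<le> int (sum_l g l) + int g - int m * int p) = (m * p \<le> sum_l g l + g)"
    by (simp flip: of_nat_mult of_nat_add)
  moreover have "(int (sum_l g l) + int g - int m * int p \<le> int q) = (sum_l g l + g \<le> m * p + q)"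
    by (simp add: diff_le_eq add.commute flip: of_nat_mult of_nat_add)
  ultimately show ?thesis
    unfolding Delta_def p by (auto simp: exponent_box_def)
qed

text \<open>The comparison runs over the whole box, the terms outside \<open>Delta\<close> being 0.
  A degree count forces the power of x supplied by the factor at the root 1: it is |l| + g - mp, or
  one less for j = 2, where that factor has exponent q-1.\<close>

lemma K_vec_eq_coeff:
  assumes g: "g \<ge> 1" and p_ge: "CARD('p::prime_card) \<ge> 2 * g + 1"
    and m: "m < g" and j: "j \<in> {1..2*g+1}"
  shows "(K_vec g m j :: 'p mod_ring mpoly) =
    coeff (\<Prod>a\<in>{1..2*g+1}. [:- norm_roots a, 1:] ^ P_exp ((CARD('p) - 1) div 2) j a)
      ((g - m) * CARD('p) - 1)"
proof -
  define q where "q = (CARD('p) - 1) div 2"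
  define I where "I = {3..2*g+1}"
  define n where "n = (g - m) * CARD('p) - 1"
  have p: "CARD('p) = 2 * q + 1"
    using odd_CARD[where 'p = 'p] p_ge g by (auto simp: q_def elim: oddE)
  have q: "q \<ge> 1" "q \<ge> g" using p p_ge g by auto
  let ?e = "P_exp q j"
  let ?E = "\<lambda>l. \<Sum>i\<in>I. ?e i - Poly_Mapping.lookup l i"
  let ?s = "sum_l g"
  let ?lhs = "\<lambda>l. if ?E l + ?e 1 \<le> n then
      (\<Prod>i\<in>I. (-1) ^ Poly_Mapping.lookup l i * of_nat (?e i choose Poly_Mapping.lookup l i)) *
        (of_nat (?e 2 choose (n - ?E l - ?e 1)) * (-1) ^ (?e 2 - (n - ?E l - ?e 1)))
      else 0 :: 'p mod_ring"
  have n: "n + m * CARD('p) + 1 = 2 * (g * q) + g"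
  proof -
    have "(g - m) * CARD('p) > 0" using m by simp
    then have "n + 1 = (g - m) * CARD('p)" by (simp add: n_def)
    then have "n + 1 + m * CARD('p) = g * CARD('p)"
      using m by (simp add: diff_mult_distrib)
    then show ?thesis by (simp add: p algebra_simps)
  qed
  have term_eq: "?lhs l = (if l \<in> Delta CARD('p) g m g then K_coeff g m l * K_dir g l j else 0)"
    if l: "l \<in> exponent_box q I" for l
  proof -
    define B where "B = (\<Prod>i\<in>I. of_nat (q choose Poly_Mapping.lookup l i) :: 'p mod_ring)"
    define d where "d = (if j \<in> I then 2 * of_nat (Poly_Mapping.lookup l j) + 1 else 1 :: 'p mod_ring)"
    define M where "M = m * CARD('p)"
    have c: "(\<Prod>i\<in>I. (-1) ^ Poly_Mapping.lookup l i * of_nat (?e i choose Poly_Mapping.lookup l i)) =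
        (-1) ^ ?s l * (d * B)"
      using prod_choose_P_exp[OF p q(1) l[unfolded I_def], of j]
      by (simp add: prod.distrib power_sum sum_l_def I_def B_def d_def)
    have K: "K_coeff g m l = (-1) ^ (q + M - g) * of_nat (q choose (?s l + g - M)) * B"
      by (simp add: K_coeff_def B_def I_def q_def M_def)
    have Delta: "l \<in> Delta CARD('p) g m g \<longleftrightarrow> M \<le> ?s l + g \<and> ?s l + g \<le> M + q"
      using Delta_iff[OF p] l by (simp add: I_def M_def)
    have K_dir: "K_dir g l j = (if j = 2 then - 2 * of_nat (?s l + g) else d)"
      using j by (auto simp: K_dir_def d_def I_def algebra_simps)
    show ?thesis
    \<comment> \<open>The degree count needs l_i <= e_i for all i, which fails in the box only if i
      = j and l_j = q. Then the coefficient is 0, so a nonzero product excludes this case.\<close>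
    proof (cases "d * B = 0")
      case True
      then have "K_coeff g m l * K_dir g l j = (0 :: 'p mod_ring)"
        unfolding K K_dir by (auto simp: d_def I_def split: if_splits)
      then show ?thesis using c True by simp
    next
      case False
      have le: "Poly_Mapping.lookup l i \<le> ?e i" if "i \<in> I" for i
      proof (rule ccontr)
        assume "\<not> ?thesis"
        then have "(\<Prod>i\<in>I. (-1) ^ Poly_Mapping.lookup l i *
            of_nat (?e i choose Poly_Mapping.lookup l i)) = (0 :: 'p mod_ring)"
          using that by (intro prod_zero) (auto simp: I_def binomial_eq_0 intro!: bexI[of _ i])
        then show False using c False by simp
      qed
      have "?E l + ?s l = (\<Sum>i\<in>I. ?e i)"
        unfolding sum_l_def I_def[symmetric] sum.distrib[symmetric]
        by (rule sum.cong) (use le in auto)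
      then have E: "?E l + ?s l + ?e 1 + ?e 2 + 1 = 2 * (g * q) + q"
        using sum_P_exp[OF g q(1) j] by (simp add: I_def algebra_simps)
      note n' = n[folded M_def]
      consider (ne2) "j \<noteq> 2" | (eq2) "j = 2" by blast
      then show ?thesis
      proof cases
        case ne2
        have e2: "?e 2 = q" using ne2 by (simp add: P_exp_def)
        show ?thesis
        proof (cases "M \<le> ?s l + g \<and> ?s l + g \<le> M + q")
          case True
          have "?E l + ?e 1 \<le> n" using E n' e2 True by linarith
          moreover have "n - ?E l - ?e 1 = ?s l + g - M" using E n' e2 True by linarith
          \<comment> \<open>The sign (-1)^|l| from the other roots and the sign from (x - 1)^q
            combine to one independent of \<open>l\<close>.\<close>
          moreover have "?s l + (q - (?s l + g - M)) = q + M - g" using True q by linarith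
          then have "(-1) ^ ?s l * (-1) ^ (q - (?s l + g - M)) = ((-1) ^ (q + M - g) :: 'p mod_ring)"
            by (simp only: power_add[symmetric])
          ultimately show ?thesis
            using True ne2 unfolding c K K_dir Delta e2
            by (simp add: mult_ac mult.left_commute[of "(-1) ^ ?s l"])
        next
          case False
          \<comment> \<open>If |l| + g is too small, the test already fails; if it is too large, the
            binomial coefficient vanishes.\<close>
          have "q < n - ?E l - ?e 1" if "?E l + ?e 1 \<le> n"
            using False E n' e2 that by linarith
          then show ?thesis
            using False unfolding c K K_dir Delta e2 by (auto simp: binomial_eq_0)
        qed
      next
        case eq2
        have e2: "?e 2 = q - 1" using eq2 by (simp add: P_exp_def)
        have d: "d = 1" using eq2 by (simp add: d_def I_def)
        have M0: "of_nat M = (0 :: 'p mod_ring)"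
          unfolding M_def of_nat_mult by simp
        show ?thesis
        \<comment> \<open>The range of nonzero terms starts one later than \<open>Delta\<close>. At
          the additional boundary |l| + g = mp the second entry of the direction vector is -2mp,
          which is 0 in F_p.\<close>
        proof (cases "M + 1 \<le> ?s l + g \<and> ?s l + g \<le> M + q")
          case True
          define v where "v = ?s l + g - M"
          have v: "?s l + g = M + v" "v \<ge> 1" "v \<le> q" using True by (auto simp: v_def)
          have "?E l + ?e 1 \<le> n" using E n' e2 True q by linarith
          moreover have "n - ?E l - ?e 1 = v - 1" using E n' e2 v q by linarith
          moreover have "?s l + (q - 1 - (v - 1)) = q + M - g" using v q by linarith
          then have "(-1) ^ ?s l * (-1) ^ (q - 1 - (v - 1)) = ((-1) ^ (q + M - g) :: 'p mod_ring)"
            by (simp only: power_add[symmetric])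
          moreover have "(of_nat (q - 1 choose (v - 1)) :: 'p mod_ring) =
              - 2 * of_nat (?s l + g) * of_nat (q choose v)"
            using of_nat_choose_pred_pred_half[OF p q(1) v(2)] M0 v(1) by (simp only: of_nat_add add_0_left)
          ultimately show ?thesis
            using True eq2 unfolding c K K_dir Delta e2 d v_def[symmetric]
            by (simp only: if_True simp_thms mult_1_left mult_ac)
               (simp add: mult_ac)
        next
          case False
          have "q - 1 < n - ?E l - ?e 1" if "?E l + ?e 1 \<le> n"
            using False E n' e2 q that by linarith
          then have lhs: "?lhs l = 0"
            unfolding e2 by (auto simp: binomial_eq_0)
          have "of_nat (?s l + g) = (0 :: 'p mod_ring)" if "l \<in> Delta CARD('p) g m g"
            using that False M0 unfolding Delta by (metis Suc_eq_plus1 le_antisym not_less_eq_eq)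
          then show ?thesis unfolding lhs K_dir using eq2 by auto
        qed
      qed
    qed
  qed
  have "finite (exponent_box q I)" by (simp add: finite_exponent_box I_def)
  have "K_vec g m j = (\<Sum>l\<in>exponent_box q I.
      Poly_Mapping.single l (if l \<in> Delta CARD('p) g m g then K_coeff g m l * K_dir g l j else 0 :: 'p mod_ring))"
    unfolding K_vec_def
    by (rule sum.mono_neutral_cong_left)
       (use \<open>finite _\<close> Delta_iff[OF p] in \<open>auto simp: I_def\<close>)
  also have "\<dots> = (\<Sum>l\<in>exponent_box q I. Poly_Mapping.single l (?lhs l))"
    by (rule sum.cong[OF refl]) (simp only: term_eq)
  also have "\<dots> = coeff (\<Prod>a\<in>{1..2*g+1}. [:- norm_roots a, 1:] ^ ?e a) n"
    unfolding I_def by (subst coeff_prod_norm_roots[OF g]) (auto simp: P_exp_def)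
  finally show ?thesis unfolding q_def n_def .
qed

section \<open>Homogeneity\<close>

text \<open>Substituting wx for x turns x - w z_a into w (x - z_a). Keeping the powers of w on both
  sides avoids division.\<close>

lemma coeff_prod_linear_scale:
  fixes z :: "'a \<Rightarrow> 'b::comm_ring_1"
  shows "w ^ n * coeff (\<Prod>a\<in>A. [:- (w * z a), 1:] ^ e a) n =
    w ^ (\<Sum>a\<in>A. e a) * coeff (\<Prod>a\<in>A. [:- z a, 1:] ^ e a) n"
proof -
  have hom: "pcompose (f ^ k) r = pcompose f r ^ k" for f r :: "'b poly" and k
    by (induction k) (auto simp: pcompose_mult pcompose_1)
  have "w ^ n * coeff (\<Prod>a\<in>A. [:- (w * z a), 1:] ^ e a) n =
      coeff (pcompose (\<Prod>a\<in>A. [:- (w * z a), 1:] ^ e a) [:0, w:]) n"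
    by (simp add: coeff_pcompose_linear)
  also have "pcompose (\<Prod>a\<in>A. [:- (w * z a), 1:] ^ e a) [:0, w:] =
      (\<Prod>a\<in>A. (smult w [:- z a, 1:]) ^ e a)"
    by (simp add: pcompose_prod hom pcompose_pCons)
  also have "\<dots> = smult (w ^ (\<Sum>a\<in>A. e a)) (\<Prod>a\<in>A. [:- z a, 1:] ^ e a)"
    by (simp only: smult_power prod_smult power_sum)
  finally show ?thesis by simp
qed

definition norm_subst :: "'k::field mpoly \<Rightarrow> 'k mpoly fract" where
  "norm_subst = msubst (\<lambda>c. to_fract (Const c))
     (\<lambda>j. to_fract (Var j - Var 1) / to_fract (Var 2 - Var 1))"

lemma comm_ring_hom_norm_subst: "comm_ring_hom norm_subst"
  unfolding norm_subst_def
  by (rule comm_ring_hom_msubst) (rule comm_ring_hom_comp[OF comm_ring_hom_to_fract comm_ring_hom_Const])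

text \<open>The left-hand side is homogeneous in the differences of the variables, and \<open>norm_subst\<close>
  dehomogenizes it.\<close>

lemma coeff_shift_eq_norm_subst:
  fixes e :: "nat \<Rightarrow> nat"
  assumes "n \<le> (\<Sum>a\<in>A. e a)"
  shows "to_fract (coeff (pcompose (\<Prod>a\<in>A. [:- Var a, 1 :: 'k::field mpoly:] ^ e a) [:Var 1, 1:]) n) =
    to_fract (Var 2 - Var 1) ^ ((\<Sum>a\<in>A. e a) - n) *
    norm_subst (coeff (\<Prod>a\<in>A. [:- norm_roots a, 1:] ^ e a) n)"
proof -
  let ?w = "to_fract (Var 2 - Var 1) :: 'k mpoly fract"
  let ?z = "\<lambda>a. norm_subst (norm_roots a) :: 'k mpoly fract"
  interpret h: comm_ring_hom "norm_subst :: 'k mpoly \<Rightarrow> _"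
    by (rule comm_ring_hom_norm_subst)
  interpret hp: map_poly_comm_ring_hom "norm_subst :: 'k mpoly \<Rightarrow> _" ..
  interpret t: comm_ring_hom "to_fract :: 'k mpoly \<Rightarrow> _"
    by (rule comm_ring_hom_to_fract)
  interpret tp: map_poly_comm_ring_hom "to_fract :: 'k mpoly \<Rightarrow> _" ..
  have hom: "pcompose (f ^ k) r = pcompose f r ^ k" for f r :: "'k mpoly poly" and k
    by (induction k) (auto simp: pcompose_mult pcompose_1)
  have w: "?w \<noteq> 0" by (simp del: to_fract_diff)
  \<comment> \<open>The scaling half of the normalization: the translated points are w times the
    normalized ones. The points 1 and 2 are separate because their normalized values are the
    constants 0 and 1.\<close>
  have z: "?w * ?z a = to_fract (Var a - Var 1)" for a
  proof (cases "a = 1 \<or> a = 2")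
    case True
    then show ?thesis by (auto simp: norm_roots_def)
  next
    case False
    then have "?z a = to_fract (Var a - Var 1) / ?w"
      by (simp add: norm_roots_def norm_subst_def msubst_Var Const_0 Const_1 del: to_fract_diff)
    then show ?thesis using w by (simp del: to_fract_diff)
  qed
  have z': "- (?w * ?z a) = to_fract (Var 1) - to_fract (Var a)" for a
    unfolding z by simp
  have "map_poly to_fract (pcompose (\<Prod>a\<in>A. [:- Var a, 1 :: 'k mpoly:] ^ e a) [:Var 1, 1:]) =
      (\<Prod>a\<in>A. [:to_fract (Var 1) - to_fract (Var a), 1:] ^ e a)"
    by (simp add: pcompose_prod hom pcompose_pCons tp.hom_prod tp.hom_power)
  from arg_cong[OF this, of "\<lambda>f. coeff f n"]
  have L: "to_fract (coeff (pcompose (\<Prod>a\<in>A. [:- Var a, 1 :: 'k mpoly:] ^ e a) [:Var 1, 1:]) n) =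
      coeff (\<Prod>a\<in>A. [:- (?w * ?z a), 1:] ^ e a) n"
    unfolding z' by (simp only: t.coeff_map_poly_hom)
  have "map_poly norm_subst (\<Prod>a\<in>A. [:- norm_roots a, 1 :: 'k mpoly:] ^ e a) =
      (\<Prod>a\<in>A. [:- ?z a, 1:] ^ e a)"
    by (simp add: hp.hom_prod hp.hom_power h.hom_uminus)
  from arg_cong[OF this, of "\<lambda>f. coeff f n"]
  have R: "norm_subst (coeff (\<Prod>a\<in>A. [:- norm_roots a, 1 :: 'k mpoly:] ^ e a) n) =
      coeff (\<Prod>a\<in>A. [:- ?z a, 1:] ^ e a) n"
    by (simp only: h.coeff_map_poly_hom)
  have pow: "?w ^ (\<Sum>a\<in>A. e a) = ?w ^ n * ?w ^ ((\<Sum>a\<in>A. e a) - n)"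
    using assms by (simp only: power_add[symmetric] le_add_diff_inverse)
  have "?w ^ n * coeff (\<Prod>a\<in>A. [:- (?w * ?z a), 1:] ^ e a) n =
      ?w ^ (\<Sum>a\<in>A. e a) * coeff (\<Prod>a\<in>A. [:- ?z a, 1:] ^ e a) n"
    by (rule coeff_prod_linear_scale)
  also have "\<dots> = ?w ^ n * (?w ^ ((\<Sum>a\<in>A. e a) - n) * coeff (\<Prod>a\<in>A. [:- ?z a, 1:] ^ e a) n)"
    unfolding pow by (rule mult.assoc)
  finally have "coeff (\<Prod>a\<in>A. [:- (?w * ?z a), 1:] ^ e a) n =
      ?w ^ ((\<Sum>a\<in>A. e a) - n) * coeff (\<Prod>a\<in>A. [:- ?z a, 1:] ^ e a) n"
    using mult_left_cancel[OF power_not_zero[OF w]] by blast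
  then show ?thesis
    unfolding L R .
qed

section \<open>The vectors \<open>J\<close> in terms of shifted solutions\<close>

lemma P_vec_eq_P_exp:
  assumes "j \<in> {1..2*g+1}" "CARD('p::prime_card) \<ge> 3"
  shows "(P_vec g j :: 'p mod_ring mpoly poly) =
    (\<Prod>a\<in>{1..2*g+1}. [:- Var a, 1:] ^ P_exp ((CARD('p) - 1) div 2) j a)"
proof -
  have "(\<Prod>a\<in>{1..2*g+1} - {j}. [:- Var a, 1 :: 'p mod_ring mpoly:] ^ P_exp ((CARD('p) - 1) div 2) j a) =
      (\<Prod>a\<in>{1..2*g+1} - {j}. [:- Var a, 1:] ^ ((CARD('p) - 1) div 2))"
    by (rule prod.cong) (auto simp: P_exp_def)
  then show ?thesis
    unfolding P_vec_eq[OF assms] using assms(1)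
    by (subst prod.remove[of _ j]) (auto simp: P_exp_def)
qed

definition coeffs_in :: "'a::zero set \<Rightarrow> 'a poly \<Rightarrow> bool" where
  "coeffs_in R f \<longleftrightarrow> (\<forall>n. coeff f n \<in> R)"

lemma coeffs_in_polys_mult:
  fixes f h :: "'k::comm_ring_1 mpoly poly"
  shows "coeffs_in (polys_in V) f \<Longrightarrow> coeffs_in (polys_in V) h \<Longrightarrow> coeffs_in (polys_in V) (f * h)"
  by (auto simp: coeffs_in_def coeff_mult intro!: polys_in_sum)

lemma coeffs_in_polys_1: "coeffs_in (polys_in V) (1 :: 'k::comm_ring_1 mpoly poly)"
  by (auto simp: coeffs_in_def coeff_pCons one_pCons split: nat.splits)

lemma coeffs_in_polys_prod_linear:
  fixes e :: "nat \<Rightarrow> nat"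
  assumes "A \<subseteq> V"
  shows "coeffs_in (polys_in V) (\<Prod>a\<in>A. [:- Var a, 1 :: 'k::comm_ring_1 mpoly:] ^ e a)"
proof -
  have lin: "coeffs_in (polys_in V) [:- Var a, 1 :: 'k mpoly:]" if "a \<in> V" for a
    using that by (auto simp: coeffs_in_def coeff_pCons split: nat.splits)
  have pow: "coeffs_in (polys_in V) ([:- Var a, 1 :: 'k mpoly:] ^ k)" if "a \<in> V" for a k
    by (induction k) (auto simp: coeffs_in_polys_1 simp del: mult_pCons_left intro!: coeffs_in_polys_mult lin that)
  show ?thesis
    using assms
    by (induction A rule: infinite_finite_induct)
       (auto simp: coeffs_in_polys_1 intro!: coeffs_in_polys_mult pow)
qed

lemma coeffs_in_polys_shift:
  fixes f :: "'k::comm_ring_1 mpoly poly"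
  assumes "coeffs_in (polys_in V) f" "c \<in> polys_in V"
  shows "coeff (pcompose f [:c, 1:]) n \<in> polys_in V"
  unfolding coeff_pcompose_shift[OF lessI]
  using assms by (intro polys_in_sum) (auto simp: coeffs_in_def)

definition Q_vec :: "nat \<Rightarrow> nat \<Rightarrow> nat \<Rightarrow> 'p::prime_card mod_ring mpoly" where
  "Q_vec g m = (\<lambda>j. if j \<in> {1..2*g+1} then
     coeff (pcompose (P_vec g j) [:Var 1, 1:]) ((g - m) * CARD('p) - 1) else 0)"

text \<open>C^r_s before the scaling. The factor x^(g-s-1) in the definition of C^r_s is absorbed
  into the index of the coefficient.\<close>

definition shifted_Cartier_Manin :: "nat \<Rightarrow> nat \<Rightarrow> nat \<Rightarrow> 'p::prime_card mod_ring mpoly" where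
  "shifted_Cartier_Manin g r s =
     coeff (pcompose (Phi g) [:Var 1, 1:]) ((g - r) * CARD('p) - 1 - (g - s - 1))"

lemma shifted_Cartier_Manin_in: "shifted_Cartier_Manin g r s \<in> polys_in {1..2*g+1}"
  unfolding shifted_Cartier_Manin_def Phi_def
  by (intro coeffs_in_polys_shift coeffs_in_polys_prod_linear) auto

section \<open>Homogenization of the factors of J\<close>

locale KZ_prime =
  fixes p :: "'p::prime_card itself" and g q :: nat
  assumes g_pos: "g \<ge> 1" and p_ge: "CARD('p) \<ge> 2 * g + 1"
    and q_def: "q = (CARD('p) - 1) div 2"
begin

lemma p3: "CARD('p) \<ge> 3"
  using g_pos p_ge by simp

lemma p_eq: "CARD('p) = 2 * q + 1"
  using odd_CARD[OF p3] by (auto simp: q_def elim: oddE)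

lemma q_ge: "q \<ge> g"
  using p_ge p_eq by simp

lemma q_pos: "q \<ge> 1"
  using q_ge g_pos by simp

lemma gp_eq: "m < g \<Longrightarrow> (g - m) * CARD('p) + m * CARD('p) = 2 * (g * q) + g"
  by (simp add: p_eq flip: add_mult_distrib)

lemma gp_pos: "m < g \<Longrightarrow> (g - m) * CARD('p) \<ge> CARD('p)"
  by simp

text \<open>The exponent is the degree (2g+1)q - 1 of P_j minus the index (g-m)p - 1.\<close>

lemma Q_vec_eq:
  assumes "m < g"
  shows "to_fract (Q_vec g m j :: 'p mod_ring mpoly) =
    to_fract (Var 2 - Var 1) ^ (q - g + m * CARD('p)) * norm_subst (K_vec g m j)"
proof (cases "j \<in> {1..2*g+1}")
  case False
  interpret h: comm_ring_hom "norm_subst :: 'p mod_ring mpoly \<Rightarrow> _"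
    by (rule comm_ring_hom_norm_subst)
  have "K_dir g l j = (0 :: 'p mod_ring)" for l
    using False g_pos by (auto simp: K_dir_def)
  then show ?thesis using False by (auto simp: Q_vec_def K_vec_def)
next
  case True
  let ?n = "(g - m) * CARD('p) - 1"
  have set: "{1..2*g+1} = insert 1 (insert 2 {3..2*g+1})" using g_pos by auto
  have T: "(\<Sum>i\<in>{1..2*g+1}. P_exp q j i) + 1 = (2 * g + 1) * q"
    using sum_P_exp[OF g_pos q_pos True] unfolding set by simp
  then have T': "(\<Sum>i\<in>{1..2*g+1}. P_exp q j i) + 1 = 2 * (g * q) + q"
    by (simp add: algebra_simps)
  have "(\<Sum>i\<in>{1..2*g+1}. P_exp q j i) - ?n = q - g + m * CARD('p)"
    "?n \<le> (\<Sum>i\<in>{1..2*g+1}. P_exp q j i)"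
    using T' gp_eq[OF assms] q_ge gp_pos[OF assms] p3 by linarith+
  then show ?thesis
    using coeff_shift_eq_norm_subst[where n = ?n and A = "{1..2*g+1}" and e = "P_exp q j" and 'k = "'p mod_ring"]
      K_vec_eq_coeff[OF g_pos p_ge assms True] True
    by (simp only: Q_vec_def if_True P_vec_eq_P_exp[OF True p3] q_def[symmetric])
qed

text \<open>The exponent is the degree (2g+1)q of Phi minus the index (g-r)p - 1 - (g-s-1).\<close>

lemma shifted_Cartier_Manin_eq:
  assumes "r < g" "s < g"
  shows "to_fract (shifted_Cartier_Manin g r s :: 'p mod_ring mpoly) =
    to_fract (Var 2 - Var 1) ^ (q - s + r * CARD('p)) * norm_subst (Cartier_Manin g r s)"
proof -
  let ?n = "(g - r) * CARD('p) - 1 - (g - s - 1)"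
  have set: "{1..2*g+1} = insert 1 (insert 2 {3..2*g+1})" using g_pos by auto
  have "(\<Prod>i\<in>{3..2*g+1}. [:- norm_roots i, 1:]) =
      (\<Prod>i\<in>{3..2*g+1}. [:- Var i, 1 :: 'p mod_ring mpoly:])"
    by (rule prod.cong) (auto simp: norm_roots_def)
  then have "[:0, 1:] * [:- 1, 1:] * (\<Prod>i\<in>{3..2*g+1}. [:- Var i, 1 :: 'p mod_ring mpoly:]) =
      (\<Prod>i\<in>{1..2*g+1}. [:- norm_roots i, 1:])"
    unfolding set by (subst prod.insert; simp add: norm_roots_def del: mult_pCons_left)+
  then have "([:0, 1:] * [:- 1, 1:] * (\<Prod>i\<in>{3..2*g+1}. [:- Var i, 1 :: 'p mod_ring mpoly:])) ^ q =
      (\<Prod>i\<in>{1..2*g+1}. [:- norm_roots i, 1:] ^ q)"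
    by (simp only: prod_power_distrib)
  moreover have "g - s - 1 \<le> (g - r) * CARD('p) - 1"
    using gp_pos[OF assms(1)] p_ge assms(2) by linarith
  ultimately have C: "Cartier_Manin g r s =
      coeff (\<Prod>i\<in>{1..2*g+1}. [:- norm_roots i, 1 :: 'p mod_ring mpoly:] ^ q) ?n"
    unfolding Cartier_Manin_def q_def[symmetric]
    by (simp only: coeff_monom_mult if_True mult_1_left)
  have T: "(\<Sum>i\<in>{1..2*g+1}. q) = 2 * (g * q) + q" by simp
  have "(\<Sum>i\<in>{1..2*g+1}. q) - ?n = q - s + r * CARD('p)"
    "?n \<le> (\<Sum>i\<in>{1..2*g+1}. q)"
    unfolding T using gp_eq[OF assms(1)] q_ge gp_pos[OF assms(1)] p_ge assms(2) by linarith+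
  then show ?thesis
    using coeff_shift_eq_norm_subst[where n = ?n and A = "{1..2*g+1}" and e = "\<lambda>_. q" and 'k = "'p mod_ring"] C
    by (simp only: shifted_Cartier_Manin_def Phi_def q_def[symmetric])
qed

text \<open>The exponent of \<open>z\<^sub>2 - z\<^sub>1\<close> in \<open>J\<close> is the sum of those by which the factors of \<open>K\<close>
  are homogenized.\<close>

lemma telescoping_exponent:
  fixes ms :: "nat \<Rightarrow> nat"
  assumes "\<forall>j\<in>{1..a}. ms j \<le> q"
  shows "q - g + ms (a + 1) * P ^ (a + 1) + (\<Sum>j\<in>{1..a}. P ^ j) * q =
    (q - g + ms 1 * P) + (\<Sum>j\<in>{1..a}. (q - ms j + ms (j + 1) * P) * P ^ j)"
  using assms
proof (induction a)
  case (Suc a)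
  \<comment> \<open>The new factor has -m_(a+1) P^(a+1) in its exponent, which cancels the last term
    for \<open>a\<close>; the bound by \<open>q\<close> makes this exact for natural
    numbers.\<close>
  have "(q - ms (a + 1)) * P ^ (a + 1) + ms (a + 1) * P ^ (a + 1) = q * P ^ (a + 1)"
    using Suc.prems by (simp flip: add_mult_distrib)
  moreover have "(\<Sum>j\<in>{1..Suc a}. P ^ j) * q = (\<Sum>j\<in>{1..a}. P ^ j) * q + q * P ^ (a + 1)"
    by (simp add: sum.cl_ivl_Suc algebra_simps)
  moreover have "(\<Sum>j\<in>{1..Suc a}. (q - ms j + ms (j + 1) * P) * P ^ j) =
      (\<Sum>j\<in>{1..a}. (q - ms j + ms (j + 1) * P) * P ^ j) +
      ((q - ms (a + 1)) * P ^ (a + 1) + ms (Suc a + 1) * P ^ (Suc a + 1))"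
    by (simp add: sum.cl_ivl_Suc add_mult_distrib)
  moreover have "q - g + ms (a + 1) * P ^ (a + 1) + (\<Sum>j\<in>{1..a}. P ^ j) * q =
      (q - g + ms 1 * P) + (\<Sum>j\<in>{1..a}. (q - ms j + ms (j + 1) * P) * P ^ j)"
    using Suc by simp
  ultimately show ?case by linarith
qed simp

definition J_scalar :: "nat list \<Rightarrow> 'p mod_ring mpoly" where
  "J_scalar ms = (let a = length ms - 2 in
     Const ((-1) ^ (a * q) * of_nat ((2 * ms ! (a + 1)) choose (ms ! (a + 1)))) *
     (\<Prod>j\<in>{1..a}. shifted_Cartier_Manin g (ms ! (j + 1)) (ms ! j) ^ (CARD('p) ^ j)))"

text \<open>The product starts at j = 1, so p divides each exponent p^j and every factor lies in
  F_p[z^p].\<close>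

lemma J_scalar_in: "J_scalar ms \<in> Fp_zp g"
  unfolding J_scalar_def Let_def
  by (intro Fp_zp_mult Fp_zp_prod Fp_zp_Const Fp_zp_power shifted_Cartier_Manin_in)
     (auto simp: dvd_power)

text \<open>The denominators disappear here: the exponent of z_2 - z_1 splits into exactly the
  powers that turn each normalized factor into a polynomial.\<close>

lemma J_seq_eq:
  assumes "ms \<in> M_seqs g"
  shows "J_seq g ms i = to_fract (J_scalar ms * (Q_vec g (ms ! 1) i :: 'p mod_ring mpoly))"
proof -
  define a where "a = length ms - 2"
  define w where "w = to_fract (Var 2 - Var 1 :: 'p mod_ring mpoly)"
  define c where "c = ((-1) ^ (a * q) * of_nat ((2 * ms ! (a + 1)) choose (ms ! (a + 1))) :: 'p mod_ring)"
  have ms: "ms ! j < g" if "j \<in> {1..a+1}" for j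
    using assms that by (auto simp: M_seqs_def a_def)
  have ms_le: "\<forall>j\<in>{1..a}. ms ! j \<le> q"
  proof
    fix j assume "j \<in> {1..a}"
    then show "ms ! j \<le> q" using ms[of j] q_ge by simp
  qed
  interpret h: comm_ring_hom "norm_subst :: 'p mod_ring mpoly \<Rightarrow> _"
    by (rule comm_ring_hom_norm_subst)
  interpret t: comm_ring_hom "to_fract :: 'p mod_ring mpoly \<Rightarrow> _"
    by (rule comm_ring_hom_to_fract)
  interpret C: comm_ring_hom "Const :: 'p mod_ring \<Rightarrow> _"
    by (rule comm_ring_hom_Const)
  let ?CM = "\<lambda>j. Cartier_Manin g (ms ! (j + 1)) (ms ! j) :: 'p mod_ring mpoly"
  let ?S = "\<lambda>j. shifted_Cartier_Manin g (ms ! (j + 1)) (ms ! j) :: 'p mod_ring mpoly"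
  have c: "norm_subst (Const c) = to_fract (Const c)"
    by (simp add: norm_subst_def msubst_Const Const_0)
  have "K_seq g ms i = Const c * (\<Prod>j\<in>{1..a}. ?CM j ^ (CARD('p) ^ j)) * K_vec g (ms ! 1) i"
    unfolding K_seq_def Let_def a_def[symmetric] q_def[symmetric]
    by (simp add: msubst_Var_power c_def C.hom_mult C.hom_power C.hom_uminus Const_of_nat)
  then have "J_seq g ms i = w ^ (q - g + ms ! (a + 1) * CARD('p) ^ (a + 1) + (\<Sum>j\<in>{1..a}. CARD('p) ^ j) * q) *
      (to_fract (Const c) * (\<Prod>j\<in>{1..a}. norm_subst (?CM j) ^ (CARD('p) ^ j)) * norm_subst (K_vec g (ms ! 1) i))"
    unfolding J_seq_def Let_def a_def[symmetric] q_def[symmetric] norm_subst_def[symmetric]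
    unfolding w_def[symmetric]
    by (simp only: h.hom_mult h.hom_prod h.hom_power c)
  also have "q - g + ms ! (a + 1) * CARD('p) ^ (a + 1) + (\<Sum>j\<in>{1..a}. CARD('p) ^ j) * q =
      (q - g + ms ! 1 * CARD('p)) + (\<Sum>j\<in>{1..a}. (q - ms ! j + ms ! (j + 1) * CARD('p)) * CARD('p) ^ j)"
    using telescoping_exponent[of a "\<lambda>j. ms ! j" "CARD('p)"] ms_le by blast
  also have "w ^ \<dots> * (to_fract (Const c) * (\<Prod>j\<in>{1..a}. norm_subst (?CM j) ^ (CARD('p) ^ j)) * norm_subst (K_vec g (ms ! 1) i)) =
      to_fract (Const c) *
      (\<Prod>j\<in>{1..a}. (w ^ (q - ms ! j + ms ! (j + 1) * CARD('p)) * norm_subst (?CM j)) ^ (CARD('p) ^ j)) *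
      (w ^ (q - g + ms ! 1 * CARD('p)) * norm_subst (K_vec g (ms ! 1) i))"
    unfolding power_add[of w "q - g + ms ! 1 * CARD('p)"] power_sum power_mult power_mult_distrib prod.distrib
    by (simp only: mult_ac)
  also have "(\<Prod>j\<in>{1..a}. (w ^ (q - ms ! j + ms ! (j + 1) * CARD('p)) * norm_subst (?CM j)) ^ (CARD('p) ^ j)) =
      (\<Prod>j\<in>{1..a}. to_fract (?S j) ^ (CARD('p) ^ j))"
  proof (rule prod.cong[OF refl], goal_cases)
    case (1 j)
    then show ?case
      using shifted_Cartier_Manin_eq[of "ms ! (j + 1)" "ms ! j"] ms[of j] ms[of "j + 1"]
      by (simp add: w_def del: to_fract_diff)
  qed
  also have "w ^ (q - g + ms ! 1 * CARD('p)) * norm_subst (K_vec g (ms ! 1) i) = to_fract (Q_vec g (ms ! 1) i)"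
    using Q_vec_eq[of "ms ! 1" i] ms[of 1] by (simp add: w_def del: to_fract_diff)
  also have "to_fract (Const c) * (\<Prod>j\<in>{1..a}. to_fract (?S j) ^ (CARD('p) ^ j)) * to_fract (Q_vec g (ms ! 1) i) =
      to_fract (J_scalar ms * Q_vec g (ms ! 1) i)"
    unfolding J_scalar_def Let_def a_def[symmetric] c_def[symmetric]
    by (simp only: t.hom_mult t.hom_prod t.hom_power)
  finally show ?thesis .
qed

section \<open>Change of generators between I and Q\<close>

lemma degree_P_vec:
  assumes "j \<in> {1..2*g+1}"
  shows "degree (P_vec g j :: 'p mod_ring mpoly poly) + 1 < (g + 1) * CARD('p)"
proof -
  have "degree (P_vec g j :: 'p mod_ring mpoly poly) \<le>
      (\<Sum>a\<in>{1..2*g+1}. degree ([:- Var a, 1 :: 'p mod_ring mpoly:] ^ P_exp q j a))"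
    unfolding P_vec_eq_P_exp[OF assms p3] q_def[symmetric] 
    using degree_prod_sum_le[of "{1..2*g+1}" "\<lambda>a. [:- Var a, 1 :: 'p mod_ring mpoly:] ^ P_exp q j a"]
    by (simp add: o_def)
  also have "\<dots> = (\<Sum>a\<in>{1..2*g+1}. P_exp q j a)"
    by (simp add: degree_linear_power)
  also have "\<dots> \<le> (\<Sum>a\<in>{1..2*g+1}. q)"
    by (rule sum_mono) (simp add: P_exp_def)
  finally have "degree (P_vec g j :: 'p mod_ring mpoly poly) \<le> (2 * g + 1) * q" by simp
  moreover have "(2 * g + 1) * q + 1 < (g + 1) * CARD('p)"
    using q_pos by (simp add: p_eq algebra_simps)
  ultimately show ?thesis by linarith
qed

text \<open>An entry of the base change matrix. For k > m, with k and m below g, the exponent of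
  \<open>c\<close> truncates to 0, but the binomial coefficient is 0; the matrix is triangular with
  diagonal 1.\<close>

definition shift_coeff :: "'p mod_ring mpoly \<Rightarrow> nat \<Rightarrow> nat \<Rightarrow> 'p mod_ring mpoly" where
  "shift_coeff c m k = of_nat (((g - k) * CARD('p) - 1) choose ((g - m) * CARD('p) - 1)) *
     c ^ (((g - k) - (g - m)) * CARD('p))"

lemma shift_coeff_in: "c \<in> polys_in {1..2*g+1} \<Longrightarrow> shift_coeff c m k \<in> Fp_zp g"
  unfolding shift_coeff_def by (intro Fp_zp_mult Fp_zp_of_nat Fp_zp_power) auto

lemma coeff_shift_eq:
  fixes f :: "'p mod_ring mpoly poly"
  assumes "degree f + 1 < (g + 1) * CARD('p)" "m < g"
  shows "coeff (pcompose f [:c, 1:]) ((g - m) * CARD('p) - 1) =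
    (\<Sum>k<g. shift_coeff c m k * coeff f ((g - k) * CARD('p) - 1))"
proof -
  have "coeff (pcompose f [:c, 1:]) ((g - m) * CARD('p) - 1) =
    (\<Sum>k=1..g+1. of_nat ((k * CARD('p) - 1) choose ((g - m) * CARD('p) - 1)) *
       c ^ ((k - (g - m)) * CARD('p)) * coeff f (k * CARD('p) - 1))"
    using coeff_pcompose_shift_prime[of f "g + 1" "g - m" c] assms by (simp add: prime_card)
  also have "\<dots> = (\<Sum>k=1..g. of_nat ((k * CARD('p) - 1) choose ((g - m) * CARD('p) - 1)) *
       c ^ ((k - (g - m)) * CARD('p)) * coeff f (k * CARD('p) - 1))"
  proof -
    \<comment> \<open>The shift formula is used with g+1 blocks because the degree may exceed gp;
      this extra coefficient lies above the degree.\<close>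
    have "coeff f ((g + 1) * CARD('p) - 1) = 0"
      using assms(1) by (intro coeff_eq_0) linarith
    then show ?thesis by (simp add: sum.cl_ivl_Suc)
  qed
  also have "\<dots> = (\<Sum>k<g. shift_coeff c m k * coeff f ((g - k) * CARD('p) - 1))"
    by (rule sum.reindex_bij_witness[where i = "\<lambda>k. g - k" and j = "\<lambda>k. g - k"])
       (auto simp: shift_coeff_def)
  finally show ?thesis .
qed

lemma Q_vec_eq_I_vec:
  assumes "m < g"
  shows "Q_vec g m j = (\<Sum>k<g. shift_coeff (Var 1) m k * I_vec g k j)"
  using coeff_shift_eq[OF degree_P_vec assms] by (auto simp: Q_vec_def I_vec_def)

text \<open>The inverse matrix comes from translating back by -z_1, the same shift formula being
  applied to the translated polynomial.\<close>

lemma I_vec_eq_Q_vec: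
  assumes "m < g"
  shows "I_vec g m j = (\<Sum>k<g. shift_coeff (- Var 1) m k * Q_vec g k j)"
proof (cases "j \<in> {1..2*g+1}")
  case True
  let ?P = "P_vec g j :: 'p mod_ring mpoly poly"
  have "degree (pcompose ?P [:Var 1, 1:]) \<le> degree ?P"
    using degree_pcompose_le[of ?P "[:Var 1, 1:]"] by simp
  then have "degree (pcompose ?P [:Var 1, 1:]) + 1 < (g + 1) * CARD('p)"
    using degree_P_vec[OF True] by linarith
  moreover have "pcompose (pcompose ?P [:Var 1, 1:]) [:- Var 1, 1:] = ?P"
    by (simp add: pcompose_pCons flip: pcompose_assoc)
  ultimately show ?thesis
    using coeff_shift_eq[of "pcompose ?P [:Var 1, 1:]" m "- Var 1"] assms True
    by (simp add: Q_vec_def I_vec_def)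
qed (auto simp: Q_vec_def I_vec_def)

lemma M_module_eq_Q_vec:
  "M_module g = {(\<lambda>i. \<Sum>m<g. c m * Q_vec g m i :: 'p mod_ring mpoly) | c. \<forall>m<g. c m \<in> Fp_zp g}"
proof -
  have change: "\<exists>d. (\<lambda>i. \<Sum>m<g. c m * v m i) = (\<lambda>i. \<Sum>k<g. d k * u k i) \<and> (\<forall>k<g. d k \<in> Fp_zp g)"
    if "\<forall>m<g. c m \<in> Fp_zp g" "z \<in> polys_in {1..2*g+1}"
      "\<And>m i. m < g \<Longrightarrow> v m i = (\<Sum>k<g. shift_coeff z m k * u k i)"
    for c z and u v :: "nat \<Rightarrow> nat \<Rightarrow> 'p mod_ring mpoly"
  proof (intro exI conjI allI impI ext)
    fix i
    have "(\<Sum>m<g. c m * v m i) = (\<Sum>m<g. \<Sum>k<g. c m * shift_coeff z m k * u k i)"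
      using that(3) by (simp add: sum_distrib_left mult.assoc)
    also have "\<dots> = (\<Sum>k<g. (\<Sum>m<g. c m * shift_coeff z m k) * u k i)"
      by (subst sum.swap) (simp add: sum_distrib_right)
    finally show "(\<Sum>m<g. c m * v m i) = (\<Sum>k<g. (\<Sum>m<g. c m * shift_coeff z m k) * u k i)" .
  next
    fix k
    show "(\<Sum>m<g. c m * shift_coeff z m k) \<in> Fp_zp g"
      using that by (intro Fp_zp_sum Fp_zp_mult shift_coeff_in) auto
  qed
  show ?thesis
    unfolding M_module_def
    using change[OF _ _ I_vec_eq_Q_vec] change[OF _ _ Q_vec_eq_I_vec]
      polys_in_uminus[OF polys_in_Var[of 1 "{1..2*g+1}"]] polys_in_Var[of 1 "{1..2*g+1}"]
    by (auto 0 3)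
qed

lemma M_module_smult_Q_vec:
  assumes "c \<in> Fp_zp g" "m < g"
  shows "(\<lambda>i. c * Q_vec g m i :: 'p mod_ring mpoly) \<in> M_module g"
proof -
  have "(\<lambda>i. c * Q_vec g m i) = (\<lambda>i. \<Sum>k<g. (if k = m then c else 0) * Q_vec g k i)"
    using assms(2) by (simp add: if_distrib[of "\<lambda>x. x * _"] cong: if_cong)
  then show ?thesis
    unfolding M_module_eq_Q_vec using assms(1) Fp_zp_0 by fastforce
qed

lemma M_module_sum:
  assumes "\<And>s. s \<in> S \<Longrightarrow> F s \<in> (M_module g :: (nat \<Rightarrow> 'p mod_ring mpoly) set)"
  shows "(\<lambda>i. \<Sum>s\<in>S. F s i) \<in> M_module g"
proof -
  have "\<exists>c. \<forall>s\<in>S. F s = (\<lambda>i. \<Sum>m<g. c s m * I_vec g m i) \<and> (\<forall>m<g. c s m \<in> Fp_zp g)"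
    using assms unfolding M_module_def by (intro bchoice) auto
  then obtain c where c: "\<And>s. s \<in> S \<Longrightarrow> F s = (\<lambda>i. \<Sum>m<g. c s m * I_vec g m i)"
    "\<And>s m. s \<in> S \<Longrightarrow> m < g \<Longrightarrow> c s m \<in> Fp_zp g" by blast
  have "(\<Sum>s\<in>S. F s i) = (\<Sum>m<g. (\<Sum>s\<in>S. c s m) * I_vec g m i)" for i
    by (simp add: c(1) sum_distrib_right sum.swap[of _ "{..<g}" S])
  moreover have "(\<Sum>s\<in>S. c s m) \<in> Fp_zp g" if "m < g" for m
    using c(2) that by (intro Fp_zp_sum) auto
  ultimately show ?thesis
    unfolding M_module_def by auto
qed

lemma M_module_poly_vecs: "(M_module g :: (nat \<Rightarrow> 'p mod_ring mpoly) set) \<subseteq> poly_vecs g"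
proof
  fix F :: "nat \<Rightarrow> 'p mod_ring mpoly"
  assume "F \<in> M_module g"
  then obtain c where F: "F = (\<lambda>i. \<Sum>m<g. c m * I_vec g m i)" and c: "\<forall>m<g. c m \<in> Fp_zp g"
    by (auto simp: M_module_def)
  have I: "I_vec g m i \<in> (polys_in {1..2*g+1} :: 'p mod_ring mpoly set)" for m i
    using coeffs_in_polys_prod_linear[OF order.refl, of "{1..2*g+1}" "P_exp q i", where 'k = "'p mod_ring"]
    by (auto simp: I_vec_def P_vec_eq_P_exp[OF _ p3] coeffs_in_def q_def)
  have "F i \<in> polys_in {1..2*g+1}" for i
    unfolding F by (intro polys_in_sum polys_in_mult I Fp_zp_subset_polys_in) (use c in auto)
  moreover have "F i = 0" if "i \<notin> {1..2*g+1}" for i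
    using that by (simp only: F I_vec_def if_False mult_zero_right sum.neutral_const)
  ultimately show "F \<in> poly_vecs g"
    unfolding poly_vecs_def by blast
qed

section \<open>Comparison of the two modules\<close>

lemma smult_J_seq_in:
  assumes "ms \<in> M_seqs g" "c \<in> Fp_zp g"
  shows "(\<lambda>i. c * J_scalar ms * Q_vec g (ms ! 1) i) \<in> M_module g"
proof -
  have "ms ! 1 < g" using assms(1) by (auto simp: M_seqs_def)
  then show ?thesis
    using assms(2) by (intro M_module_smult_Q_vec Fp_zp_mult J_scalar_in)
qed

lemma J_seq_in_M_module:
  assumes "ms \<in> M_seqs g"
  shows "(J_seq g ms :: nat \<Rightarrow> 'p mod_ring mpoly fract) \<in> vec_to_fract ` M_module g"
proof -
  have "J_seq g ms = vec_to_fract (\<lambda>i. 1 * J_scalar ms * Q_vec g (ms ! 1) i)"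
    using J_seq_eq[OF assms] by (auto simp: vec_to_fract_def)
  then show ?thesis
    using smult_J_seq_in[OF assms Fp_zp_1] by blast
qed

text \<open>The binomial coefficient divides (2m)!, whose prime factors are at most 2m, and 2m <
  p.\<close>

lemma central_binomial_neq_0:
  assumes "m < g"
  shows "of_nat ((2 * m) choose m) \<noteq> (0 :: 'p mod_ring)"
proof
  assume "of_nat ((2 * m) choose m) = (0 :: 'p mod_ring)"
  then have "CARD('p) dvd (2 * m) choose m"
    by (rule of_nat_0_mod_ring_dvd)
  moreover have "(2 * m choose m) dvd fact (2 * m)"
    using binomial_fact_lemma[of m "2 * m"] by (metis dvd_triv_right le_add2 mult_2)
  ultimately have "CARD('p) dvd fact (2 * m)" by (rule dvd_trans)
  then have "CARD('p) \<le> 2 * m"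
    using prime_dvd_fact_iff[OF prime_card[where 'a = 'p]] by simp
  then show False using p_ge assms by simp
qed

lemma J_module_eq:
  "(J_module g :: (nat \<Rightarrow> 'p mod_ring mpoly fract) set) = vec_to_fract ` M_module g"
proof (intro subset_antisym subsetI)
  fix F :: "nat \<Rightarrow> 'p mod_ring mpoly fract"
  assume "F \<in> J_module g"
  then obtain S c where F: "F = (\<lambda>i. \<Sum>ms\<in>S. to_fract (c ms) * J_seq g ms i)"
    and S: "S \<subseteq> M_seqs g" and c: "\<forall>ms\<in>S. c ms \<in> Fp_zp g"
    by (auto simp: J_module_def)
  have "F = vec_to_fract (\<lambda>i. \<Sum>ms\<in>S. c ms * J_scalar ms * Q_vec g (ms ! 1) i)"
    unfolding F vec_to_fract_def to_fract_sum
    by (intro ext sum.cong refl) (use S J_seq_eq in \<open>auto simp: mult.assoc\<close>)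
  moreover have "(\<lambda>i. \<Sum>ms\<in>S. c ms * J_scalar ms * Q_vec g (ms ! 1) i) \<in> M_module g"
    by (rule M_module_sum) (use S c smult_J_seq_in in blast)
  ultimately show "F \<in> vec_to_fract ` M_module g" by blast
next
  fix F :: "nat \<Rightarrow> 'p mod_ring mpoly fract"
  assume "F \<in> vec_to_fract ` M_module g"
  then obtain c where F: "F = vec_to_fract (\<lambda>i. \<Sum>m<g. c m * Q_vec g m i :: 'p mod_ring mpoly)"
    and c: "\<forall>m<g. c m \<in> Fp_zp g"
    by (auto simp: M_module_eq_Q_vec)
  define b where "b m = Const (of_nat ((2 * m) choose m) :: 'p mod_ring)" for m
  \<comment> \<open>For the two-term sequence [g, m] the scalar in front of Q is \<open>b m\<close>,
    a nonzero element of F_p, so dividing by it stays inside F_p[z^p].\<close>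
  define b' where "b' m = Const (inverse (of_nat ((2 * m) choose m)) :: 'p mod_ring)" for m
  have b: "b' m * b m = 1" if "m < g" for m
    using central_binomial_neq_0[OF that] unfolding b_def b'_def Const_def mult_single by simp
  have inj: "inj_on (\<lambda>m. [g, m]) {..<g}" by (auto simp: inj_on_def)
  let ?S = "(\<lambda>m. [g, m]) ` {..<g}"
  have S: "[g, m] \<in> M_seqs g" if "m < g" for m
    using that by (auto simp: M_seqs_def)
  have "F i = (\<Sum>ms\<in>?S. to_fract (c (ms ! 1) * b' (ms ! 1)) * J_seq g ms i)" for i
  proof -
    have "to_fract (c m * b' m) * J_seq g [g, m] i = to_fract (c m * Q_vec g m i)" if "m < g" for m
    proof -
      have "J_seq g [g, m] i = to_fract (b m * Q_vec g m i)"
        unfolding J_seq_eq[OF S[OF that]] by (simp add: J_scalar_def b_def)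
      moreover have "c m * b' m * (b m * Q_vec g m i) = c m * (b' m * b m) * Q_vec g m i"
        by (simp only: mult_ac)
      ultimately show ?thesis
        using b[OF that] by (simp only: to_fract_mult[symmetric] mult_1_right)
    qed
    then show ?thesis
      unfolding sum.reindex[OF inj] by (simp add: F vec_to_fract_def del: to_fract_mult)
  qed
  moreover have "c (ms ! 1) * b' (ms ! 1) \<in> Fp_zp g" if "ms \<in> ?S" for ms
    using that c by (auto simp: b'_def intro: Fp_zp_mult Fp_zp_Const)
  moreover have "?S \<subseteq> M_seqs g" using S by auto
  ultimately show "F \<in> J_module g"
    unfolding J_module_def mem_Collect_eq
    by (intro exI[of _ ?S] exI[of _ "\<lambda>ms. c (ms ! 1) * b' (ms ! 1)"]) auto
qed

end

theorem theorem7p5: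
  fixes g :: nat
  assumes "g \<ge> 1"
    and "CARD('p::prime_card) \<ge> 2 * g + 1"
  shows "(\<forall>ms\<in>M_seqs g.
            (J_seq g ms :: nat \<Rightarrow> 'p mod_ring mpoly fract) \<in> vec_to_fract ` poly_vecs g) \<and>
         (\<forall>ms\<in>M_seqs g. \<forall>F\<in>poly_vecs g.
            vec_to_fract F = (J_seq g ms :: nat \<Rightarrow> 'p mod_ring mpoly fract) \<longrightarrow> KZ_solution g F) \<and>
         (J_module g :: (nat \<Rightarrow> 'p mod_ring mpoly fract) set) = vec_to_fract ` M_module g"
proof -
  interpret KZ_prime "TYPE('p)" g "(CARD('p) - 1) div 2"
    by unfold_locales (use assms in auto)
  \<comment> \<open>A polynomial vector representing J is unique, so it is the one already known to
    lie in \<open>M_module g\<close>.\<close>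
  have inj: "inj (vec_to_fract :: (nat \<Rightarrow> 'p mod_ring mpoly) \<Rightarrow> _)"
    by (auto simp: inj_def vec_to_fract_def fun_eq_iff)
  have "(J_seq g ms :: nat \<Rightarrow> 'p mod_ring mpoly fract) \<in> vec_to_fract ` poly_vecs g"
    if "ms \<in> M_seqs g" for ms
    using J_seq_in_M_module[OF that] M_module_poly_vecs by blast
  moreover have "KZ_solution g F"
    if "ms \<in> M_seqs g" "vec_to_fract F = (J_seq g ms :: nat \<Rightarrow> 'p mod_ring mpoly fract)" for ms F
  proof (rule KZ_solution_M_module[OF p3])
    show "F \<in> M_module g"
      using J_seq_in_M_module[OF that(1)] that(2) inj by (auto dest: injD)
  qed
  ultimately show ?thesis
    using J_module_eq by blast
qed

end
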